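(* Under the standing setup (Assumption A on $p,n,b$ and Assumption Z on $\{Z_j\}$), the empirical eigenvalue measure $L=L^{(p)}=p^{-1}\sum_{i=1}^p\delta_{\lambda_i^{(p)}}$ of the banded sample covariance matrix $Y=Y^{(p)}$ converges weakly to $\nu_Z$, in probability, as $p\to\infty$.
   Context: Joint cumulant: for real random variables $X_1,\dots,X_k$ with moments of all orders, $\mathbf C(X_1,\dots,X_k)=i^{-k}\frac{\partial^k}{\partial t_1\cdots\partial t_k}\log \mathbf E\exp(\sum_{j=1}^k i t_jX_j)\big|_{t=0}$. Assumption A: $p$ is a positive integer, $b=b(p)>0$ and $n=n(p)$ a positive integer depending on $p$; as $p\to\infty$, $b\to\infty$, $n\to\infty$, $b/n\to0$, and $b\le p$. Assumption Z: $\{Z_j\}_{j\in\mathbb Z}$ is a stationary sequence of real random variables with (1) $\mathbf E|Z_0|^k<\infty$ for all $k\ge1$, (2) $\mathbf EZ_0=0$, (3) $\sum_{j_1,\dots,j_r\in\mathbb Z}|\mathbf C(Z_0,Z_{j_1},\dots,Z_{j_r})|<\infty$ for all $r\ge1$. Matrices: let $\{\{Z^{(i)}_j\}_{j\in\mathbb Z}\}_{i\ge1}$ be i.i.d. copies of $\{Z_j\}$; $X$ is the $n\times p$ matrix with $X_{ij}=Z^{(i)}_j/\sqrt n$; $B$ is the $p\times p$ matrix with $B_{ij}=1$ if $|i-j|\le b$ and $0$ otherwise; $Y$ is the $p\times p$ symmetric matrix $Y_{ij}=B_{ij}(X^TX)_{ij}$, with eigenvalues $\lambda^{(p)}_1,\dots,\lambda^{(p)}_p$.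 Let $R(j)=\mathrm{Cov}(Z_0,Z_j)$, spectral density $f_Z(\theta)=\sum_{j\in\mathbb Z}e^{2\pi i j\theta}R(j)$ on $[0,1]$, and $\nu_Z=m\circ f_Z^{-1}$, where $m$ is Lebesgue measure on $[0,1]$ (equivalently $\int x^k\,\nu_Z(dx)=\int_0^1 f_Z(\theta)^k d\theta$ for all $k$). *)

theory Defs
  imports "HOL-Probability.Probability" "Jordan_Normal_Form.Char_Poly"
begin

definition joint_char_fun :: "'a measure \<Rightarrow> ('a \<Rightarrow> real) list \<Rightarrow> (nat \<Rightarrow> real) \<Rightarrow> complex" where
  "joint_char_fun M Xs t = (\<integral>\<omega>. cis (\<Sum>j<length Xs. t j * (Xs ! j) \<omega>) \<partial>M)"

fun iter_pderiv :: "nat list \<Rightarrow> ((nat \<Rightarrow> real) \<Rightarrow> complex) \<Rightarrow> (nat \<Rightarrow> real) \<Rightarrow> complex" where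
  "iter_pderiv [] F = F"
| "iter_pderiv (j # js) F =
     (\<lambda>t. vector_derivative (\<lambda>s. iter_pderiv js F (t(j := s))) (at (t j)))"

definition cumulant :: "'a measure \<Rightarrow> ('a \<Rightarrow> real) list \<Rightarrow> complex" where
  "cumulant M Xs =
     (- \<i>) ^ length Xs *
     iter_pderiv [0..<length Xs] (\<lambda>t. Ln (joint_char_fun M Xs t)) (\<lambda>_. 0)"

definition autocov :: "'a measure \<Rightarrow> (int \<Rightarrow> 'a \<Rightarrow> real) \<Rightarrow> int \<Rightarrow> real" where
  "autocov M Z j =
     (\<integral>\<omega>. (Z 0 \<omega> - (\<integral>\<omega>'. Z 0 \<omega>' \<partial>M)) * (Z j \<omega> - (\<integral>\<omega>'. Z j \<omega>' \<partial>M)) \<partial>M)"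

definition spectral_density :: "'a measure \<Rightarrow> (int \<Rightarrow> 'a \<Rightarrow> real) \<Rightarrow> real \<Rightarrow> complex" where
  "spectral_density M Z \<theta> =
     (\<Sum>\<^sub>\<infinity>j\<in>(UNIV::int set). exp (2 * pi * \<i> * of_int j * of_real \<theta>) * of_real (autocov M Z j))"

text \<open>nu_Z = m o f_Z^{-1} (f_Z is real-valued; we take its real part to land in R).\<close>
definition nu_Z :: "'a measure \<Rightarrow> (int \<Rightarrow> 'a \<Rightarrow> real) \<Rightarrow> real measure" where
  "nu_Z M Z = distr (lebesgue_on {0..1}) borel (\<lambda>\<theta>. Re (spectral_density M Z \<theta>))"

text \<open>X is n x p with X_{ij} = Z^{(i)}_j / sqrt n (paper indices i = 1..n, j = 1..p);
  Y_{ij} = B_{ij} (X^T X)_{ij} with B_{ij} = 1 iff |i-j| <= b.  The JNF matrix uses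
  0-based indices, so JNF entry (i,j) is the paper's entry (i+1,j+1).\<close>
definition banded_cov :: "(nat \<Rightarrow> int \<Rightarrow> 'a \<Rightarrow> real) \<Rightarrow> nat \<Rightarrow> real \<Rightarrow> nat \<Rightarrow> 'a \<Rightarrow> real mat" where
  "banded_cov Zc n b p \<omega> =
     mat p p (\<lambda>(i, j).
       if \<bar>real i - real j\<bar> \<le> b
       then (\<Sum>k\<in>{1..n}. (Zc k (int (i + 1)) \<omega> / sqrt (real n)) * (Zc k (int (j + 1)) \<omega> / sqrt (real n)))
       else 0)"

definition empirical_eigen_measure :: "real mat \<Rightarrow> real measure" where
  "empirical_eigen_measure A = measure_pmf (pmf_of_multiset (proots (char_poly A)))"

definition weak_conv_in_prob :: "'a measure \<Rightarrow> (nat \<Rightarrow> 'a \<Rightarrow> real measure) \<Rightarrow> real measure \<Rightarrow> bool" where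
  "weak_conv_in_prob M L \<nu> \<longleftrightarrow>
     (\<forall>f :: real \<Rightarrow> real. continuous_on UNIV f \<and> bounded (range f) \<longrightarrow>
        (\<forall>p. (\<lambda>\<omega>. \<integral>x. f x \<partial>(L p \<omega>)) \<in> borel_measurable M) \<and>
        (\<forall>\<epsilon>>0. (\<lambda>p. measure M {\<omega> \<in> space M. \<bar>(\<integral>x. f x \<partial>(L p \<omega>)) - (\<integral>x. f x \<partial>\<nu>)\<bar> > \<epsilon>})
                  \<longlonglongrightarrow> 0))"

end

theory Submission
  imports Defs
begin

text \<open>
  The second joint cumulant is the covariance, so the case \<open>r = 1\<close> of the cumulant condition says that the
  autocovariance \<open>R\<close> is absolutely summable.

  If \<open>A = \<Sum> \<lambda>\<^sub>i u\<^sub>i u\<^sub>i\<^sup>T\<close> and \<open>B = \<Sum> \<mu>\<^sub>j v\<^sub>j v\<^sub>j\<^sup>T\<close> are symmetric, the weights \<open>(u\<^sub>i \<bullet> v\<^sub>j)\<^sup>2\<close> are doubly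
  stochastic and \<open>\<Sum> (u\<^sub>i \<bullet> v\<^sub>j)\<^sup>2 (\<lambda>\<^sub>i - \<mu>\<^sub>j)\<^sup>2\<close> is the squared Frobenius norm of \<open>A - B\<close>. Hence empirical
  spectral measures of matrices whose difference has squared Frobenius norm \<open>o(p)\<close> have the same weak limits.

  Each entry of \<open>Y\<close> in the band is a mean of \<open>n\<close> independent copies of \<open>Z\<^sub>i Z\<^sub>j\<close>, so its variance
  is at most \<open>E Z\<^sub>0\<^sup>4 / n\<close>. With \<open>O(p b)\<close> entries in the band, the squared Frobenius distance from \<open>Y\<close> to its
  mean is \<open>O(p b / n) = o(p)\<close>. Cutting the mean down to a fixed band \<open>m\<close> costs at most
  \<open>p \<Sum>\<^bsub>|s| > m\<^esub> R(s)\<^sup>2\<close>. What is left is a Toeplitz matrix with a trigonometric polynomial \<open>f\<^sub>m\<close> as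
  symbol: the normalised trace of its \<open>k\<close>-th power tends to the constant Fourier coefficient of \<open>f\<^sub>m\<^sup>k\<close>, because
  all but \<open>O(1)\<close> diagonal entries are equal to it. Finally \<open>f\<^sub>m\<close> tends to \<open>f\<^sub>Z\<close> uniformly.
\<close>

unbundle no vec_syntax
unbundle no inner_syntax

section \<open>The spectral theorem for real symmetric matrices\<close>

text \<open>The characteristic polynomial has a complex root \<open>z\<close>, with eigenvector
  \<open>v = x + i y\<close>. Symmetry forces \<open>Im z = 0\<close>; then \<open>x\<close> and
  \<open>y\<close> satisfy the eigenvalue equation over the reals, and they cannot both
  vanish.\<close>

lemma real_symmetric_eigenvector:
  fixes A :: "real mat"
  assumes A: "A \<in> carrier_mat n n" and sym: "transpose_mat A = A" and n: "n > 0"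
  shows "\<exists>e v. v \<in> carrier_vec n \<and> v \<noteq> 0\<^sub>v n \<and> A *\<^sub>v v = e \<cdot>\<^sub>v v"
proof -
  define C where "C = map_mat complex_of_real A"
  have C: "C \<in> carrier_mat n n" using A by (simp add: C_def)
  have "degree (char_poly C) = n" using degree_monic_char_poly[OF C] by simp
  hence "\<not> constant (poly (char_poly C))" using n by (simp add: constant_degree)
  then obtain z where "poly (char_poly C) z = 0"
    using fundamental_theorem_of_algebra by blast
  hence "eigenvalue C z" using eigenvalue_root_char_poly[OF C] by simp
  then obtain v where v: "v \<in> carrier_vec n" "v \<noteq> 0\<^sub>v n" "C *\<^sub>v v = z \<cdot>\<^sub>v v"
    using C unfolding eigenvalue_def eigenvector_def by auto
  define x where "x = map_vec Re v"
  define y where "y = map_vec Im v"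
  have xy: "x \<in> carrier_vec n" "y \<in> carrier_vec n" using v(1) by (auto simp: x_def y_def)
  have comp: "(\<Sum>j<n. complex_of_real (A $$ (i,j)) * v $ j) = z * v $ i" if "i < n" for i
  proof -
    have "(C *\<^sub>v v) $ i = z * v $ i" using v that by simp
    thus ?thesis using A C v(1) that
      by (simp add: scalar_prod_def C_def lessThan_atLeast0)
  qed
  have cx: "(\<Sum>j<n. A $$ (i,j) * x $ j) = Re z * x $ i - Im z * y $ i" if "i < n" for i
    using arg_cong[OF comp[OF that], of Re] v(1) that by (simp add: x_def y_def)
  have cy: "(\<Sum>j<n. A $$ (i,j) * y $ j) = Re z * y $ i + Im z * x $ i" if "i < n" for i
    using arg_cong[OF comp[OF that], of Im] v(1) that by (simp add: x_def y_def)
  have s: "A $$ (i,j) = A $$ (j,i)" if "i < n" "j < n" for i j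
    using arg_cong[OF sym, of "\<lambda>M. M $$ (i,j)"] A that by simp
  \<comment> \<open>The bilinear form of \<open>A\<close> at \<open>x\<close> and \<open>y\<close>
    is symmetric. Inserting the two eigenvalue equations leaves \<open>Im z\<close> times the
    squared norm of \<open>v\<close>.\<close>
  have "(\<Sum>i<n. y $ i * (\<Sum>j<n. A $$ (i,j) * x $ j)) = (\<Sum>i<n. x $ i * (\<Sum>j<n. A $$ (i,j) * y $ j))"
    unfolding sum_distrib_left
    by (subst sum.swap) (intro sum.cong refl, auto simp: s mult_ac)
  hence "(\<Sum>i<n. y $ i * (Re z * x $ i - Im z * y $ i)) = (\<Sum>i<n. x $ i * (Re z * y $ i + Im z * x $ i))"
    by (simp add: cx cy)
  hence "Im z * (\<Sum>i<n. (x $ i)\<^sup>2 + (y $ i)\<^sup>2) = 0"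
    by (simp add: sum_distrib_left sum.distrib sum_subtractf algebra_simps power2_eq_square)
  moreover have "(\<Sum>i<n. (x $ i)\<^sup>2 + (y $ i)\<^sup>2) \<noteq> 0"
  proof
    assume "(\<Sum>i<n. (x $ i)\<^sup>2 + (y $ i)\<^sup>2) = 0"
    hence "\<forall>i\<in>{..<n}. (x $ i)\<^sup>2 + (y $ i)\<^sup>2 = 0"
      by (subst (asm) sum_nonneg_eq_0_iff) auto
    hence "v = 0\<^sub>v n" using v(1)
      by (intro eq_vecI) (auto simp: x_def y_def complex_eq_iff sum_power2_eq_zero_iff)
    thus False using v(2) by simp
  qed
  ultimately have z0: "Im z = 0" by simp
  have Ax: "A *\<^sub>v x = Re z \<cdot>\<^sub>v x"
    by (rule eq_vecI) (use A xy cx z0 in \<open>auto simp: scalar_prod_def lessThan_atLeast0\<close>)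
  have Ay: "A *\<^sub>v y = Re z \<cdot>\<^sub>v y"
    by (rule eq_vecI) (use A xy cy z0 in \<open>auto simp: scalar_prod_def lessThan_atLeast0\<close>)
  have "x \<noteq> 0\<^sub>v n \<or> y \<noteq> 0\<^sub>v n"
  proof (rule ccontr)
    assume *: "\<not> ?thesis"
    have "v = 0\<^sub>v n"
    proof (rule eq_vecI)
      fix i assume i: "i < dim_vec (0\<^sub>v n :: complex vec)"
      have "x $ i = 0" "y $ i = 0" using * i by auto
      thus "v $ i = 0\<^sub>v n $ i" using v(1) i by (simp add: x_def y_def complex_eq_iff)
    qed (use v(1) in auto)
    thus False using v(2) by simp
  qed
  thus ?thesis using xy Ax Ay by blast
qed

text \<open>With \<open>w = v - e_0\<close>, the reflection \<open>1 - 2 w w^T / (w^T w)\<close>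
  exchanges the unit vectors \<open>v\<close> and \<open>e_0\<close>. Being its own inverse and
  transpose, it is an orthogonal change of basis that carries \<open>e_0\<close> to a given
  eigenvector.\<close>

lemma householder_reflection:
  fixes v :: "real vec"
  assumes v: "v \<in> carrier_vec n" "v \<bullet> v = 1" and n: "n > 0"
  shows "\<exists>H. H \<in> carrier_mat n n \<and> transpose_mat H = H \<and> H * H = 1\<^sub>m n \<and> H *\<^sub>v unit_vec n 0 = v"
proof -
  define w where "w i = v $ i - (if i = 0 then 1 else 0)" for i
  define W where "W = (\<Sum>i<n. w i * w i)"
  \<comment> \<open>For \<open>v\<close> the first basis vector, \<open>W = 0\<close>, so \<open>c = 2 / 0 = 0\<close> and \<open>H\<close> is the identity, as it should be.\<close>
  define c where "c = 2 / W"
  define H where "H = mat n n (\<lambda>(i,j). (if i = j then 1 else 0) - c * w i * w j)"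
  have H: "H \<in> carrier_mat n n" by (simp add: H_def)
  have vv: "(\<Sum>i<n. v $ i * v $ i) = 1"
    using v by (simp add: scalar_prod_def lessThan_atLeast0)
  have W: "W = - 2 * w 0"
  proof -
    have "W = (\<Sum>i<n. v $ i * v $ i - 2 * (if i = 0 then v $ i else 0) + (if i = 0 then 1 else 0))"
      unfolding W_def w_def by (intro sum.cong refl) (auto simp: algebra_simps)
    also have "\<dots> = 1 - 2 * v $ 0 + 1"
      using n by (simp add: sum.distrib sum_subtractf vv flip: sum_distrib_left)
    finally show ?thesis by (simp add: w_def)
  qed
  have cW: "c * c * W = 2 * c" by (simp add: c_def)
  have "H * H = 1\<^sub>m n"
  proof (rule eq_matI)
    fix i j assume ij: "i < dim_row (1\<^sub>m n :: real mat)" "j < dim_col (1\<^sub>m n :: real mat)"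
    have "(H * H) $$ (i,j) = (\<Sum>k<n. ((if i = k then 1 else 0) - c * w i * w k) * ((if k = j then 1 else 0) - c * w k * w j))"
      using ij by (simp add: H_def scalar_prod_def lessThan_atLeast0)
    also have "\<dots> = (\<Sum>k<n. (if i = k then if k = j then 1 else 0 else 0) - (if i = k then c * w k * w j else 0)
        - (if k = j then c * w i * w k else 0) + c * c * w i * w j * (w k * w k))"
      by (intro sum.cong refl) (auto simp: algebra_simps)
    also have "\<dots> = (if i = j then 1 else 0) - 2 * c * w i * w j + c * c * w i * w j * W"
      using ij by (simp add: sum.distrib sum_subtractf W_def flip: sum_distrib_left)
    also have "\<dots> = (if i = j then 1 else 0) + (c * c * W - 2 * c) * w i * w j" by (simp add: algebra_simps)
    also have "\<dots> = (if i = j then 1 else 0)" by (simp add: cW)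
    finally show "(H * H) $$ (i,j) = 1\<^sub>m n $$ (i,j)" using ij by simp
  qed (simp_all add: H_def)
  moreover have "transpose_mat H = H" by (rule eq_matI) (auto simp: H_def)
  moreover have "H *\<^sub>v unit_vec n 0 = v"
  proof (rule eq_vecI)
    fix i assume i: "i < dim_vec v"
    have "(H *\<^sub>v unit_vec n 0) $ i = (if i = 0 then 1 else 0) - c * w i * w 0"
      using i v n by (simp add: H_def scalar_prod_def if_distrib cong: if_cong)
    also have "\<dots> = v $ i"
    proof (cases "W = 0")
      case True
      hence "w i * w i = 0" using i v unfolding W_def
        by (subst (asm) sum_nonneg_eq_0_iff) auto
      thus ?thesis by (simp add: w_def)
    next
      case False
      hence "c * w 0 = -1" using W by (simp add: c_def field_simps)
      hence "c * w i * w 0 = - w i" by (metis mult.assoc mult.commute mult_minus1_right)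
      thus ?thesis by (simp add: w_def)
    qed
    finally show "(H *\<^sub>v unit_vec n 0) $ i = v $ i" .
  qed (use v H in auto)
  ultimately show ?thesis using H by blast
qed

text \<open>Induction on the dimension. After a reflection moves a unit eigenvector to
  \<open>e_0\<close>, a block of size one splits off, since symmetry clears the first row along with
  the first column; the induction hypothesis diagonalises the rest.\<close>

lemma real_spectral_theorem:
  fixes A :: "real mat"
  assumes "A \<in> carrier_mat n n" and "transpose_mat A = A"
  shows "\<exists>U d. U \<in> carrier_mat n n \<and> U * transpose_mat U = 1\<^sub>m n \<and> transpose_mat U * U = 1\<^sub>m n
    \<and> A = U * mat_diag n d * transpose_mat U"
  using assms
proof (induction n arbitrary: A)
  case 0
  show ?case by (rule exI[of _ "1\<^sub>m 0"], rule exI[of _ "\<lambda>_. 0"]) (use 0 in \<open>auto intro!: eq_matI\<close>)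
next
  case (Suc n)
  note A = Suc.prems(1) and sym = Suc.prems(2)
  let ?N = "Suc n"
  obtain e v0 where v0: "v0 \<in> carrier_vec ?N" "v0 \<noteq> 0\<^sub>v ?N" "A *\<^sub>v v0 = e \<cdot>\<^sub>v v0"
    using real_symmetric_eigenvector[OF A sym] by auto
  define s where "s = 1 / sqrt (v0 \<bullet> v0)"
  define v where "v = s \<cdot>\<^sub>v v0"
  have pos: "v0 \<bullet> v0 > 0"
  proof -
    have "\<exists>i<?N. v0 $ i \<noteq> 0"
    proof (rule ccontr)
      assume "\<not> ?thesis"
      hence "v0 = 0\<^sub>v ?N" using v0(1) by (intro eq_vecI) auto
      thus False using v0(2) by simp
    qed
    then obtain i where i: "i < ?N" "v0 $ i \<noteq> 0" by blast
    have "0 < v0 $ i * v0 $ i" using i(2) not_real_square_gt_zero by blast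
    also have "\<dots> \<le> (\<Sum>i\<in>{0..<?N}. v0 $ i * v0 $ i)"
      by (rule member_le_sum) (use i in auto)
    also have "\<dots> = v0 \<bullet> v0" using v0(1) by (simp add: scalar_prod_def del: sum.op_ivl_Suc)
    finally show ?thesis .
  qed
  have v: "v \<in> carrier_vec ?N" using v0 by (simp add: v_def)
  have "v \<bullet> v = s * s * (v0 \<bullet> v0)" using v0(1) by (simp add: v_def)
  also have "\<dots> = 1" using pos by (simp add: s_def field_simps)
  finally have vv: "v \<bullet> v = 1" .
  have Av: "A *\<^sub>v v = e \<cdot>\<^sub>v v"
    using A v0 by (simp add: v_def mult_mat_vec smult_smult_assoc mult.commute)
  obtain H where H: "H \<in> carrier_mat ?N ?N" "transpose_mat H = H" "H * H = 1\<^sub>m ?N"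
      "H *\<^sub>v unit_vec ?N 0 = v"
    using householder_reflection[OF v vv] by auto
  define B where "B = H * A * H"
  have B: "B \<in> carrier_mat ?N ?N" using H A by (simp add: B_def)
  have Bsym: "transpose_mat B = B"
    unfolding B_def using H A sym by (simp add: transpose_mult[of _ ?N ?N _ ?N])
  have "B *\<^sub>v unit_vec ?N 0 = H *\<^sub>v (A *\<^sub>v (H *\<^sub>v unit_vec ?N 0))"
    unfolding B_def using H A
    by (simp add: assoc_mult_mat_vec[of _ ?N ?N _ ?N])
  also have "\<dots> = e \<cdot>\<^sub>v (H *\<^sub>v v)" using H(1) v by (simp add: H(4) Av mult_mat_vec)
  also have "H *\<^sub>v v = (H * H) *\<^sub>v unit_vec ?N 0" using H(1)
    by (simp add: H(4)[symmetric] assoc_mult_mat_vec[of _ ?N ?N _ ?N])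
  also have "\<dots> = unit_vec ?N 0" by (simp add: H(3))
  finally have Be: "B *\<^sub>v unit_vec ?N 0 = e \<cdot>\<^sub>v unit_vec ?N 0" .
  have B0: "B $$ (i,0) = (if i = 0 then e else 0)" if "i < ?N" for i
    using arg_cong[OF Be, of "\<lambda>x. x $ i"] B that by (auto simp: scalar_prod_right_unit split: if_splits)
  have Bs: "B $$ (i,j) = B $$ (j,i)" if "i < ?N" "j < ?N" for i j
    using arg_cong[OF Bsym, of "\<lambda>M. M $$ (i,j)"] B that by simp
  define A' where "A' = mat n n (\<lambda>(i,j). B $$ (Suc i, Suc j))"
  have A': "A' \<in> carrier_mat n n" by (simp add: A'_def)
  have A's: "transpose_mat A' = A'"
    by (rule eq_matI) (auto simp: A'_def Bs)
  obtain U' d' where U': "U' \<in> carrier_mat n n" "U' * transpose_mat U' = 1\<^sub>m n"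
      "transpose_mat U' * U' = 1\<^sub>m n" "A' = U' * mat_diag n d' * transpose_mat U'"
    using Suc.IH[OF A' A's] by blast
  \<comment> \<open>\<open>V\<close> fixes \<open>e_0\<close> and acts as \<open>U'\<close> on the
    remaining coordinates, so it diagonalises both blocks of \<open>B\<close> at once.\<close>
  define V where "V = four_block_mat (1\<^sub>m 1) (0\<^sub>m 1 n) (0\<^sub>m n 1) U'"
  define d where "d = case_nat e d'"
  have V: "V \<in> carrier_mat ?N ?N" using four_block_carrier_mat[of "1\<^sub>m 1" 1 1 U' n n] U' by (simp add: V_def)
  have VT: "transpose_mat V = four_block_mat (1\<^sub>m 1) (0\<^sub>m 1 n) (0\<^sub>m n 1) (transpose_mat U')"
    unfolding V_def using U' by (subst transpose_four_block_mat[of _ 1 1 _ n _ n]) auto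
  have D: "mat_diag ?N d = four_block_mat (mat 1 1 (\<lambda>_. e)) (0\<^sub>m 1 n) (0\<^sub>m n 1) (mat_diag n d')"
    by (rule eq_matI) (auto simp: mat_diag_def d_def split: nat.splits)
  have BB: "B = four_block_mat (mat 1 1 (\<lambda>_. e)) (0\<^sub>m 1 n) (0\<^sub>m n 1) A'"
  proof (rule eq_matI)
    fix i j assume "i < dim_row (four_block_mat (mat 1 1 (\<lambda>_. e)) (0\<^sub>m 1 n) (0\<^sub>m n 1) A')"
      "j < dim_col (four_block_mat (mat 1 1 (\<lambda>_. e)) (0\<^sub>m 1 n) (0\<^sub>m n 1) A')"
    hence "i < ?N" "j < ?N" by (auto simp: A'_def)
    thus "B $$ (i,j) = four_block_mat (mat 1 1 (\<lambda>_. e)) (0\<^sub>m 1 n) (0\<^sub>m n 1) A' $$ (i,j)"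
      using B0[of i] B0[of j] Bs[of i j] by (cases i; cases j) (auto simp: A'_def)
  qed (use B in \<open>auto simp: A'_def\<close>)
  have VD: "V * mat_diag ?N d = four_block_mat (mat 1 1 (\<lambda>_. e)) (0\<^sub>m 1 n) (0\<^sub>m n 1) (U' * mat_diag n d')"
    unfolding D V_def using U' left_mult_zero_mat[of "mat_diag n d'" n n 1]
    by (subst mult_four_block_mat[of _ 1 1 _ n _ n _ _ 1 _ n]) auto
  have VDV: "V * mat_diag ?N d * transpose_mat V = B"
    unfolding VT VD BB using U' right_mult_zero_mat[of "U' * mat_diag n d'" n n 1]
      left_add_zero_mat[of "U' * mat_diag n d' * transpose_mat U'" n n]
    by (subst mult_four_block_mat[of _ 1 1 _ n _ n _ _ 1 _ n]) auto
  have VV: "V * transpose_mat V = 1\<^sub>m ?N" "transpose_mat V * V = 1\<^sub>m ?N"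
    unfolding VT unfolding V_def using U'
    by (subst mult_four_block_mat[of _ 1 1 _ n _ n _ _ 1 _ n], auto)+
  define U where "U = H * V"
  have U: "U \<in> carrier_mat ?N ?N" using H V by (simp add: U_def)
  have UT: "transpose_mat U = transpose_mat V * H"
    unfolding U_def using H V by (simp add: transpose_mult[of _ ?N ?N _ ?N])
  have c: "transpose_mat V \<in> carrier_mat ?N ?N" "mat_diag ?N d \<in> carrier_mat ?N ?N" using V by auto
  \<comment> \<open>Associativity and closure are restated for a single size, so that rewriting can
    discharge the dimension conditions and bracket every product to the right.\<close>
  have am: "X * Y * Z = X * (Y * Z)" if "X \<in> carrier_mat ?N ?N" "Y \<in> carrier_mat ?N ?N" "Z \<in> carrier_mat ?N ?N"
    for X Y Z :: "real mat" using that by simp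
  have cl: "X * Y \<in> carrier_mat ?N ?N" if "X \<in> carrier_mat ?N ?N" "Y \<in> carrier_mat ?N ?N"
    for X Y :: "real mat" using that by simp
  note ac = am cl H(1) V c A
  have "U * transpose_mat U = H * ((V * transpose_mat V) * H)"
    unfolding UT unfolding U_def by (simp only: ac)
  hence 1: "U * transpose_mat U = 1\<^sub>m ?N" using H by (simp add: VV)
  have "transpose_mat U * U = transpose_mat V * ((H * H) * V)"
    unfolding UT unfolding U_def by (simp only: ac)
  hence 2: "transpose_mat U * U = 1\<^sub>m ?N" using H V by (simp add: VV)
  have "U * mat_diag ?N d * transpose_mat U = H * (V * mat_diag ?N d * transpose_mat V) * H"
    unfolding UT unfolding U_def by (simp only: ac)
  also have "\<dots> = (H * H) * A * (H * H)"
    unfolding VDV B_def by (simp only: ac)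
  also have "\<dots> = A" using A by (simp add: H(3))
  finally show ?case using U 1 2 by metis
qed

section \<open>Comparison of two spectra\<close>

text \<open>Matrices are functions of indices here, which suits double sums. \<open>u i a\<close> is
  coordinate \<open>a\<close> of the \<open>i\<close>-th eigenvector. Orthonormality and
  completeness of the eigenvectors are recorded side by side, as the sums below use both.\<close>

definition spectral_decomp :: "nat \<Rightarrow> (nat \<Rightarrow> nat \<Rightarrow> real) \<Rightarrow> (nat \<Rightarrow> real) \<Rightarrow> (nat \<Rightarrow> nat \<Rightarrow> real) \<Rightarrow> bool" where
  "spectral_decomp p A d u \<longleftrightarrow>
     (\<forall>i<p. \<forall>j<p. (\<Sum>a<p. u i a * u j a) = of_bool (i = j)) \<and>
     (\<forall>a<p. \<forall>b<p. (\<Sum>i<p. u i a * u i b) = of_bool (a = b)) \<and>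
     (\<forall>a<p. \<forall>b<p. A a b = (\<Sum>i<p. d i * u i a * u i b))"

lemma spectral_decompD:
  assumes "spectral_decomp p A d u"
  shows "\<And>i j. i < p \<Longrightarrow> j < p \<Longrightarrow> (\<Sum>a<p. u i a * u j a) = of_bool (i = j)"
    and "\<And>a b. a < p \<Longrightarrow> b < p \<Longrightarrow> (\<Sum>i<p. u i a * u i b) = of_bool (a = b)"
    and "\<And>a b. a < p \<Longrightarrow> b < p \<Longrightarrow> A a b = (\<Sum>i<p. d i * u i a * u i b)"
  using assms unfolding spectral_decomp_def by auto

text \<open>Similarity to a diagonal matrix preserves the characteristic polynomial, so
  \<open>d\<close> lists its roots with multiplicity. This ties the decomposition to
  \<open>empirical_eigen_measure\<close>, which sees only those roots.\<close>

lemma spectral_decomp_ex: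
  fixes A :: "real mat"
  assumes A: "A \<in> carrier_mat p p" and sym: "transpose_mat A = A"
  shows "\<exists>d u. spectral_decomp p (\<lambda>a b. A $$ (a, b)) d u \<and> proots (char_poly A) = mset (map d [0..<p])"
proof -
  obtain U d where U: "U \<in> carrier_mat p p" "U * transpose_mat U = 1\<^sub>m p" "transpose_mat U * U = 1\<^sub>m p"
    "A = U * mat_diag p d * transpose_mat U"
    using real_spectral_theorem[OF A sym] by blast
  define u where "u i a = U $$ (a, i)" for i a
  have 1: "(\<Sum>a<p. u i a * u j a) = of_bool (i = j)" if "i < p" "j < p" for i j
    using arg_cong[OF U(3), of "\<lambda>M. M $$ (i,j)"] U(1) that
    by (simp add: u_def scalar_prod_def lessThan_atLeast0 split: if_splits)
  have 2: "(\<Sum>i<p. u i a * u i b) = of_bool (a = b)" if "a < p" "b < p" for a b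
    using arg_cong[OF U(2), of "\<lambda>M. M $$ (a,b)"] U(1) that
    by (simp add: u_def scalar_prod_def lessThan_atLeast0 split: if_splits)
  have 3: "A $$ (a,b) = (\<Sum>i<p. d i * u i a * u i b)" if "a < p" "b < p" for a b
    using arg_cong[OF U(4), of "\<lambda>M. M $$ (a,b)"] U(1) that
    by (simp add: u_def scalar_prod_def lessThan_atLeast0 mat_diag_mult_right[of _ p] mult_ac)
  have "similar_mat A (mat_diag p d)"
    by (rule similar_matI[of _ _ U "transpose_mat U" p]) (use A U in auto)
  hence "char_poly A = char_poly (mat_diag p d)" by (rule char_poly_similar)
  also have "\<dots> = (\<Prod>a\<leftarrow>diag_mat (mat_diag p d). [:- a, 1:])"
    by (rule char_poly_upper_triangular[of _ p]) (auto simp: mat_diag_def)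
  also have "diag_mat (mat_diag p d) = map d [0..<p]"
    by (simp add: diag_mat_def mat_diag_def)
  finally have cp: "char_poly A = (\<Prod>a\<leftarrow>map d [0..<p]. [:- a, 1:])" .
  have "proots (\<Prod>a\<leftarrow>xs. [:- a, 1:]) = mset xs" for xs :: "real list"
  proof (induction xs)
    case (Cons x xs)
    have "(\<Prod>a\<leftarrow>xs. [:- a, 1:]) \<noteq> 0" by (auto simp: prod_list_zero_iff)
    thus ?case using Cons proots_mult[of "[:- x, 1:]" "\<Prod>a\<leftarrow>xs. [:- a, 1:]"]
      by (simp del: mult_pCons_left)
  qed simp
  hence "proots (char_poly A) = mset (map d [0..<p])" by (simp only: cp)
  moreover have "spectral_decomp p (\<lambda>a b. A $$ (a, b)) d u"
    unfolding spectral_decomp_def using 1 2 3 by blast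
  ultimately show ?thesis by blast
qed

text \<open>The uniform distribution on the multiset of roots is the image under \<open>d\<close> of
  the uniform distribution on the indices below \<open>p\<close>.\<close>

lemma integral_empirical_eigen_measure:
  fixes f :: "real \<Rightarrow> real"
  assumes "p > 0" and "proots (char_poly A) = mset (map d [0..<p])"
  shows "(\<integral>x. f x \<partial>(empirical_eigen_measure A)) = (\<Sum>i<p. f (d i)) / real p"
proof -
  have "mset (map d [0..<p]) = image_mset d (mset_set {..<p})"
    by (simp add: lessThan_atLeast0 flip: mset_upt)
  hence "pmf_of_multiset (proots (char_poly A)) = map_pmf d (pmf_of_set {..<p})"
    using assms by (simp add: map_pmf_of_set lessThan_empty_iff)
  thus ?thesis unfolding empirical_eigen_measure_def
    using assms(1) by (simp add: integral_pmf_of_set lessThan_empty_iff)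
qed

lemma sum_swap3: "(\<Sum>i\<in>A. \<Sum>j\<in>B. \<Sum>k\<in>C. f i j k) = (\<Sum>j\<in>B. \<Sum>k\<in>C. \<Sum>i\<in>A. f i j k)"
proof -
  have "(\<Sum>i\<in>A. \<Sum>j\<in>B. \<Sum>k\<in>C. f i j k) = (\<Sum>j\<in>B. \<Sum>i\<in>A. \<Sum>k\<in>C. f i j k)" by (rule sum.swap)
  also have "\<dots> = (\<Sum>j\<in>B. \<Sum>k\<in>C. \<Sum>i\<in>A. f i j k)" by (intro sum.cong refl sum.swap)
  finally show ?thesis .
qed

text \<open>Parseval's identity: the completeness relation of \<open>v\<close> collapses the
  expanded square to its diagonal.\<close>

lemma sum_sq_orthonormal:
  fixes x :: "nat \<Rightarrow> real"
  assumes v: "\<And>a b. a < p \<Longrightarrow> b < p \<Longrightarrow> (\<Sum>j<p. v j a * v j b) = of_bool (a = b)"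
  shows "(\<Sum>j<p. (\<Sum>b<p. x b * v j b)\<^sup>2) = (\<Sum>b<p. (x b)\<^sup>2)"
proof -
  have "(\<Sum>j<p. (\<Sum>b<p. x b * v j b)\<^sup>2) = (\<Sum>j<p. \<Sum>a<p. \<Sum>b<p. x a * x b * (v j a * v j b))"
    by (simp add: power2_eq_square sum_product mult_ac)
  also have "\<dots> = (\<Sum>a<p. \<Sum>b<p. \<Sum>j<p. x a * x b * (v j a * v j b))"
    by (rule sum_swap3)
  also have "\<dots> = (\<Sum>a<p. \<Sum>b<p. x a * x b * of_bool (a = b))"
    by (intro sum.cong refl) (auto simp: v simp flip: sum_distrib_left)
  also have "\<dots> = (\<Sum>b<p. (x b)\<^sup>2)"
    by (intro sum.cong refl) (simp add: of_bool_def if_distrib power2_eq_square cong: if_cong)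
  finally show ?thesis .
qed

text \<open>The hypothesis on \<open>f\<close> is asymmetric on purpose: only the eigenvalues
  \<open>e j\<close> of the second matrix serve as base points. In the application these belong to a
  Toeplitz matrix and are bounded, while the eigenvalues \<open>d i\<close> of the random matrix may
  be any reals.\<close>

lemma spectral_comparison:
  fixes f :: "real \<Rightarrow> real"
  assumes A: "spectral_decomp p A d u" and B: "spectral_decomp p B e v"
    and f: "\<And>x j. j < p \<Longrightarrow> \<bar>f x - f (e j)\<bar> \<le> \<epsilon> + C * (x - e j)\<^sup>2"
  shows "\<bar>(\<Sum>i<p. f (d i)) - (\<Sum>j<p. f (e j))\<bar> \<le> \<epsilon> * p + C * (\<Sum>a<p. \<Sum>b<p. (A a b - B a b)\<^sup>2)"
proof -
  note A' = spectral_decompD[OF A] and B' = spectral_decompD[OF B]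
  \<comment> \<open>The numbers \<open>(w i j)\<^sup>2\<close> form a doubly stochastic matrix, so the two spectra are compared
    through the coupling they define.\<close>
  define w where "w i j = (\<Sum>a<p. u i a * v j a)" for i j
  have w1: "(\<Sum>j<p. (w i j)\<^sup>2) = 1" if "i < p" for i
    using sum_sq_orthonormal[of p v "u i", OF B'(2)] A'(1)[OF that that]
    by (simp add: w_def power2_eq_square)
  have w2: "(\<Sum>i<p. (w i j)\<^sup>2) = 1" if "j < p" for j
    using sum_sq_orthonormal[of p u "v j", OF A'(2)] B'(1)[OF that that]
    by (simp add: w_def power2_eq_square mult.commute)
  have uA: "(\<Sum>a<p. u i a * A a b) = d i * u i b" if "i < p" "b < p" for i b
  proof -
    have "(\<Sum>a<p. u i a * A a b) = (\<Sum>a<p. \<Sum>k<p. d k * u k b * (u i a * u k a))"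
      using that by (simp add: A'(3) sum_distrib_left mult_ac)
    also have "\<dots> = (\<Sum>k<p. d k * u k b * of_bool (i = k))"
      by (subst sum.swap) (intro sum.cong refl, auto simp: A'(1) that simp flip: sum_distrib_left)
    also have "\<dots> = d i * u i b" using that by (simp add: of_bool_def if_distrib cong: if_cong)
    finally show ?thesis .
  qed
  have Bv: "(\<Sum>b<p. B a b * v j b) = e j * v j a" if "j < p" "a < p" for j a
  proof -
    have "(\<Sum>b<p. B a b * v j b) = (\<Sum>b<p. \<Sum>k<p. e k * v k a * (v k b * v j b))"
      using that by (simp add: B'(3) sum_distrib_right sum_distrib_left mult_ac)
    also have "\<dots> = (\<Sum>k<p. e k * v k a * of_bool (k = j))"
      by (subst sum.swap) (intro sum.cong refl, auto simp: B'(1) that simp flip: sum_distrib_left)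
    also have "\<dots> = e j * v j a" using that by (simp add: of_bool_def if_distrib cong: if_cong)
    finally show ?thesis .
  qed
  have uMv: "(\<Sum>b<p. (\<Sum>a<p. u i a * (A a b - B a b)) * v j b) = (d i - e j) * w i j"
    if "i < p" "j < p" for i j
  proof -
    have "(\<Sum>b<p. (\<Sum>a<p. u i a * (A a b - B a b)) * v j b)
        = (\<Sum>b<p. (\<Sum>a<p. u i a * A a b) * v j b) - (\<Sum>b<p. \<Sum>a<p. u i a * (B a b * v j b))"
      by (simp add: algebra_simps sum_subtractf sum_distrib_left sum_distrib_right)
    also have "(\<Sum>b<p. (\<Sum>a<p. u i a * A a b) * v j b) = d i * w i j"
      using that by (simp add: uA) (simp add: w_def sum_distrib_left mult_ac)
    also have "(\<Sum>b<p. \<Sum>a<p. u i a * (B a b * v j b)) = (\<Sum>a<p. u i a * (\<Sum>b<p. B a b * v j b))"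
      by (subst sum.swap) (simp add: sum_distrib_left)
    also have "\<dots> = e j * w i j"
      using that by (simp add: Bv) (simp add: w_def sum_distrib_left mult_ac)
    finally show ?thesis by (simp add: algebra_simps)
  qed
  \<comment> \<open>In the two eigenbases \<open>A - B\<close> has the entries
    \<open>(d i - e j) * w i j\<close>. Parseval in each index turns their squares into the squared
    Frobenius norm.\<close>
  have HS: "(\<Sum>i<p. \<Sum>j<p. (w i j)\<^sup>2 * (d i - e j)\<^sup>2) = (\<Sum>a<p. \<Sum>b<p. (A a b - B a b)\<^sup>2)"
  proof -
    have "(\<Sum>i<p. \<Sum>j<p. (w i j)\<^sup>2 * (d i - e j)\<^sup>2)
        = (\<Sum>i<p. \<Sum>j<p. (\<Sum>b<p. (\<Sum>a<p. u i a * (A a b - B a b)) * v j b)\<^sup>2)"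
      by (intro sum.cong refl) (simp add: uMv power_mult_distrib)
    also have "\<dots> = (\<Sum>i<p. \<Sum>b<p. (\<Sum>a<p. u i a * (A a b - B a b))\<^sup>2)"
    proof (rule sum.cong[OF refl])
      fix i
      show "(\<Sum>j<p. (\<Sum>b<p. (\<Sum>a<p. u i a * (A a b - B a b)) * v j b)\<^sup>2)
          = (\<Sum>b<p. (\<Sum>a<p. u i a * (A a b - B a b))\<^sup>2)"
        by (rule sum_sq_orthonormal) (rule B'(2))
    qed
    also have "\<dots> = (\<Sum>b<p. \<Sum>i<p. (\<Sum>a<p. (A a b - B a b) * u i a)\<^sup>2)"
      by (subst sum.swap) (simp add: mult.commute)
    also have "\<dots> = (\<Sum>b<p. \<Sum>a<p. (A a b - B a b)\<^sup>2)"
    proof (rule sum.cong[OF refl])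
      fix b
      show "(\<Sum>i<p. (\<Sum>a<p. (A a b - B a b) * u i a)\<^sup>2) = (\<Sum>a<p. (A a b - B a b)\<^sup>2)"
        by (rule sum_sq_orthonormal) (rule A'(2))
    qed
    also have "\<dots> = (\<Sum>a<p. \<Sum>b<p. (A a b - B a b)\<^sup>2)" by (rule sum.swap)
    finally show ?thesis .
  qed
  \<comment> \<open>Unit row sums and unit column sums let both traces be written as double sums
    with the same weights.\<close>
  have s1: "(\<Sum>i<p. f (d i)) = (\<Sum>i<p. \<Sum>j<p. (w i j)\<^sup>2 * f (d i))"
    by (intro sum.cong refl) (simp add: w1 flip: sum_distrib_right)
  have s2: "(\<Sum>j<p. f (e j)) = (\<Sum>i<p. \<Sum>j<p. (w i j)\<^sup>2 * f (e j))"
    by (subst sum.swap, intro sum.cong refl) (simp add: w2 flip: sum_distrib_right)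
  have "\<bar>(\<Sum>i<p. f (d i)) - (\<Sum>j<p. f (e j))\<bar> = \<bar>\<Sum>i<p. \<Sum>j<p. (w i j)\<^sup>2 * (f (d i) - f (e j))\<bar>"
    by (simp add: s1 s2 sum_subtractf algebra_simps)
  also have "\<dots> \<le> (\<Sum>i<p. \<Sum>j<p. (w i j)\<^sup>2 * (\<epsilon> + C * (d i - e j)\<^sup>2))"
    by (intro order_trans[OF sum_abs] sum_mono) (auto simp: abs_mult intro!: mult_left_mono f)
  also have "\<dots> = \<epsilon> * (\<Sum>i<p. \<Sum>j<p. (w i j)\<^sup>2) + C * (\<Sum>i<p. \<Sum>j<p. (w i j)\<^sup>2 * (d i - e j)\<^sup>2)"
    by (simp add: sum_distrib_left sum.distrib algebra_simps)
  also have "(\<Sum>i<p. \<Sum>j<p. (w i j)\<^sup>2) = p" by (simp add: w1)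
  finally show ?thesis by (simp add: HS)
qed

section \<open>Matrix powers, traces and a bound on the eigenvalues\<close>

fun mpow :: "nat \<Rightarrow> (nat \<Rightarrow> nat \<Rightarrow> real) \<Rightarrow> nat \<Rightarrow> nat \<Rightarrow> nat \<Rightarrow> real" where
  "mpow p A 0 i j = of_bool (i = j)"
| "mpow p A (Suc k) i j = (\<Sum>l<p. A i l * mpow p A k l j)"

lemma spectral_decomp_mpow:
  assumes A: "spectral_decomp p A d u" and "i < p" "j < p"
  shows "mpow p A k i j = (\<Sum>m<p. d m ^ k * u m i * u m j)"
  using assms(2,3)
proof (induction k arbitrary: i)
  case 0
  thus ?case by (simp add: spectral_decompD(2)[OF A])
next
  case (Suc k)
  have "mpow p A (Suc k) i j = (\<Sum>l<p. \<Sum>m<p. A i l * (d m ^ k * u m l * u m j))"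
    using Suc by (simp add: sum_distrib_left)
  also have "\<dots> = (\<Sum>l<p. \<Sum>m<p. \<Sum>q<p. d q * u q i * d m ^ k * u m j * (u q l * u m l))"
    using Suc.prems by (intro sum.cong refl) (auto simp: spectral_decompD(3)[OF A] sum_distrib_right intro!: sum.cong)
  also have "\<dots> = (\<Sum>m<p. \<Sum>q<p. \<Sum>l<p. d q * u q i * d m ^ k * u m j * (u q l * u m l))"
    by (rule sum_swap3)
  also have "\<dots> = (\<Sum>m<p. \<Sum>q<p. d q * u q i * d m ^ k * u m j * of_bool (q = m))"
    by (intro sum.cong refl) (auto simp: spectral_decompD(1)[OF A] simp flip: sum_distrib_left)
  also have "\<dots> = (\<Sum>m<p. d m ^ Suc k * u m i * u m j)"
    by (intro sum.cong refl) (simp add: of_bool_def if_distrib mult_ac cong: if_cong)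
  finally show ?case .
qed

text \<open>Expresses power sums of eigenvalues through matrix entries alone. This serves both the
  moments of the Toeplitz matrices and the measurability of sums over random eigenvalues.\<close>

lemma trace_mpow:
  assumes A: "spectral_decomp p A d u"
  shows "(\<Sum>i<p. mpow p A k i i) = (\<Sum>m<p. d m ^ k)"
proof -
  have "(\<Sum>i<p. mpow p A k i i) = (\<Sum>i<p. \<Sum>m<p. d m ^ k * (u m i * u m i))"
    by (simp add: spectral_decomp_mpow[OF A] mult_ac)
  also have "\<dots> = (\<Sum>m<p. d m ^ k)"
    by (subst sum.swap, intro sum.cong refl) (auto simp: spectral_decompD(1)[OF A] simp flip: sum_distrib_left)
  finally show ?thesis .
qed

text \<open>The matrix norm induced by the l1 norm is the largest absolute column sum, and it
  dominates every eigenvalue; \<open>S\<close> is the l1 norm of the eigenvector.\<close>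

lemma spectral_decomp_eigenvalue_bound:
  assumes A: "spectral_decomp p A d u" and K: "\<And>b. b < p \<Longrightarrow> (\<Sum>a<p. \<bar>A a b\<bar>) \<le> K" and m: "m < p"
  shows "\<bar>d m\<bar> \<le> K"
proof -
  have eig: "(\<Sum>b<p. A a b * u m b) = d m * u m a" if "a < p" for a
  proof -
    have "(\<Sum>b<p. A a b * u m b) = (\<Sum>b<p. \<Sum>k<p. d k * u k a * (u k b * u m b))"
      using that by (simp add: spectral_decompD(3)[OF A] sum_distrib_right sum_distrib_left mult_ac)
    also have "\<dots> = (\<Sum>k<p. d k * u k a * of_bool (k = m))"
      by (subst sum.swap) (intro sum.cong refl, auto simp: spectral_decompD(1)[OF A] m simp flip: sum_distrib_left)
    also have "\<dots> = d m * u m a" using m by (simp add: of_bool_def if_distrib cong: if_cong)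
    finally show ?thesis .
  qed
  define S where "S = (\<Sum>a<p. \<bar>u m a\<bar>)"
  have "S \<noteq> 0"
  proof
    assume "S = 0"
    hence "\<forall>a<p. u m a = 0" unfolding S_def by (subst (asm) sum_nonneg_eq_0_iff) auto
    hence "(\<Sum>a<p. u m a * u m a) = 0" by simp
    thus False using spectral_decompD(1)[OF A m m] by simp
  qed
  hence S: "S > 0" unfolding S_def by (simp add: sum_nonneg less_le)
  have "\<bar>d m\<bar> * S = (\<Sum>a<p. \<bar>\<Sum>b<p. A a b * u m b\<bar>)"
    by (simp add: S_def eig sum_distrib_left abs_mult)
  also have "\<dots> \<le> (\<Sum>a<p. \<Sum>b<p. \<bar>A a b\<bar> * \<bar>u m b\<bar>)"
    by (intro sum_mono order_trans[OF sum_abs]) (simp add: abs_mult)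
  also have "\<dots> = (\<Sum>b<p. (\<Sum>a<p. \<bar>A a b\<bar>) * \<bar>u m b\<bar>)"
    by (subst sum.swap) (simp add: sum_distrib_right)
  also have "\<dots> \<le> (\<Sum>b<p. K * \<bar>u m b\<bar>)" by (intro sum_mono mult_right_mono K) auto
  also have "\<dots> = K * S" by (simp add: S_def sum_distrib_left)
  finally show ?thesis using S by simp
qed

section \<open>Banded Toeplitz matrices\<close>

text \<open>The \<open>k\<close>-fold convolution power of \<open>r\<close> cut off to
  \<open>{-m..m}\<close>. For even \<open>r\<close> its values are the Fourier coefficients of the
  \<open>k\<close>-th power of the symbol \<open>trig m r\<close>.\<close>

fun conv_pow :: "nat \<Rightarrow> (int \<Rightarrow> real) \<Rightarrow> nat \<Rightarrow> int \<Rightarrow> real" where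
  "conv_pow m r 0 l = of_bool (l = 0)"
| "conv_pow m r (Suc k) l = (\<Sum>s\<in>{-int m..int m}. r s * conv_pow m r k (l - s))"

definition toep :: "nat \<Rightarrow> (int \<Rightarrow> real) \<Rightarrow> nat \<Rightarrow> nat \<Rightarrow> real" where
  "toep m r i j = (if \<bar>int i - int j\<bar> \<le> int m then r (int i - int j) else 0)"

definition trig :: "nat \<Rightarrow> (int \<Rightarrow> real) \<Rightarrow> real \<Rightarrow> real" where
  "trig m r \<theta> = (\<Sum>s\<in>{-int m..int m}. r s * cos (2 * pi * of_int s * \<theta>))"

lemma continuous_on_trig: "continuous_on S (trig m r)"
  unfolding trig_def by (intro continuous_intros)

lemma abs_trig_le: "\<bar>trig m r \<theta>\<bar> \<le> (\<Sum>s\<in>{-int m..int m}. \<bar>r s\<bar>)"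
  unfolding trig_def
  by (intro order_trans[OF sum_abs] sum_mono) (auto simp: abs_mult intro!: mult_left_le)

text \<open>Indexing a row by the offset \<open>s = i - l\<close> turns the product into a
  convolution, except that near the boundary some offsets are missing.\<close>

lemma toep_row_sum:
  fixes g :: "nat \<Rightarrow> real"
  shows "(\<Sum>l<p. toep m r i l * g l) =
    (\<Sum>s\<in>{s\<in>{-int m..int m}. 0 \<le> int i - s \<and> int i - s < int p}. r s * g (nat (int i - s)))"
proof -
  have "(\<Sum>l<p. toep m r i l * g l) = (\<Sum>l\<in>{l\<in>{..<p}. \<bar>int i - int l\<bar> \<le> int m}. r (int i - int l) * g l)"
    by (rule sum.mono_neutral_cong_right) (auto simp: toep_def)
  also have "\<dots> = (\<Sum>s\<in>{s\<in>{-int m..int m}. 0 \<le> int i - s \<and> int i - s < int p}. r s * g (nat (int i - s)))"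
    by (rule sum.reindex_bij_witness[of _ "\<lambda>s. nat (int i - s)" "\<lambda>l. int i - int l"]) auto
  finally show ?thesis .
qed

lemma toep_abs_row_sum: "(\<Sum>l<p. \<bar>toep m r i l\<bar>) \<le> (\<Sum>s\<in>{-int m..int m}. \<bar>r s\<bar>)"
proof -
  have "(\<Sum>l<p. \<bar>toep m r i l\<bar>) = (\<Sum>l<p. toep m (\<lambda>s. \<bar>r s\<bar>) i l * 1)"
    by (intro sum.cong refl) (simp add: toep_def)
  also have "\<dots> \<le> (\<Sum>s\<in>{-int m..int m}. \<bar>r s\<bar>)"
    unfolding toep_row_sum by (auto intro!: sum_mono2)
  finally show ?thesis .
qed

lemma toep_sym:
  assumes "\<And>s. r (- s) = r s"
  shows "toep m r i j = toep m r j i"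
  using assms[of "int i - int j"] by (simp add: toep_def abs_minus_commute)

lemma mpow_toep_bound: "\<bar>mpow p (toep m r) k i j\<bar> \<le> (\<Sum>s\<in>{-int m..int m}. \<bar>r s\<bar>) ^ k"
proof (induction k arbitrary: i)
  case (Suc k)
  let ?K = "\<Sum>s\<in>{-int m..int m}. \<bar>r s\<bar>"
  have "\<bar>mpow p (toep m r) (Suc k) i j\<bar> \<le> (\<Sum>l<p. \<bar>toep m r i l\<bar> * ?K ^ k)"
    unfolding mpow.simps
    by (intro order_trans[OF sum_abs] sum_mono) (auto simp: abs_mult intro!: mult_left_mono Suc)
  also have "\<dots> \<le> ?K * ?K ^ k"
    unfolding sum_distrib_right[symmetric]
    by (intro mult_right_mono toep_abs_row_sum zero_le_power sum_nonneg) auto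
  finally show ?case by simp
qed simp

text \<open>A walk of \<open>k\<close> steps of length at most \<open>m\<close> that starts from
  such an \<open>i\<close> never leaves the index range, so no term of the convolution is
  lost.\<close>

lemma mpow_toep_interior:
  assumes "k * m \<le> i" "i + k * m < p"
  shows "mpow p (toep m r) k i j = conv_pow m r k (int i - int j)"
  using assms
proof (induction k arbitrary: i)
  case (Suc k)
  have "{s\<in>{-int m..int m}. 0 \<le> int i - s \<and> int i - s < int p} = {-int m..int m}"
    using Suc.prems by auto
  hence "mpow p (toep m r) (Suc k) i j = (\<Sum>s\<in>{-int m..int m}. r s * mpow p (toep m r) k (nat (int i - s)) j)"
    by (simp add: toep_row_sum)
  also have "\<dots> = (\<Sum>s\<in>{-int m..int m}. r s * conv_pow m r k ((int i - int j) - s))"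
  proof (intro sum.cong refl)
    fix s assume s: "s \<in> {-int m..int m}"
    have 1: "k * m \<le> nat (int i - s)" "nat (int i - s) + k * m < p"
      using s Suc.prems by auto
    have "int i - s \<ge> 0" using s Suc.prems by auto
    hence eq: "int (nat (int i - s)) - int j = (int i - int j) - s" by simp
    show "r s * mpow p (toep m r) k (nat (int i - s)) j = r s * conv_pow m r k ((int i - int j) - s)"
      by (simp only: Suc.IH[OF 1] eq)
  qed
  finally show ?case by simp
qed simp

text \<open>Interior diagonal entries equal the constant exactly, and at most
  \<open>2 * (k * m)\<close> entries lie near the ends. This count does not depend on
  \<open>p\<close>, so the error disappears after division by \<open>p\<close>.\<close>

lemma trace_mpow_toep:
  "\<bar>(\<Sum>i<p. mpow p (toep m r) k i i) - real p * conv_pow m r k 0\<bar>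
     \<le> 2 * real (k * m) * ((\<Sum>s\<in>{-int m..int m}. \<bar>r s\<bar>) ^ k + \<bar>conv_pow m r k 0\<bar>)"
proof -
  let ?K = "\<Sum>s\<in>{-int m..int m}. \<bar>r s\<bar>" and ?c = "conv_pow m r k 0"
  \<comment> \<open>The indices too close to an end. Truncated subtraction makes
    \<open>p - k * m\<close> zero for small \<open>p\<close>, and then every index counts as a
    boundary index.\<close>
  let ?B = "{..<k * m} \<union> {p - k * m..<p}"
  have "(\<Sum>i<p. mpow p (toep m r) k i i) - real p * ?c = (\<Sum>i<p. mpow p (toep m r) k i i - ?c)"
    by (simp add: sum_subtractf)
  also have "\<dots> = (\<Sum>i\<in>{..<p} \<inter> ?B. mpow p (toep m r) k i i - ?c)"
  proof (rule sum.mono_neutral_right)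
    show "\<forall>i\<in>{..<p} - {..<p} \<inter> ?B. mpow p (toep m r) k i i - ?c = 0"
    proof
      fix i assume "i \<in> {..<p} - {..<p} \<inter> ?B"
      hence "k * m \<le> i" "i + k * m < p" by auto
      thus "mpow p (toep m r) k i i - ?c = 0" by (simp add: mpow_toep_interior)
    qed
  qed auto
  also have "\<bar>\<dots>\<bar> \<le> (\<Sum>i\<in>{..<p} \<inter> ?B. ?K ^ k + \<bar>?c\<bar>)"
  proof (intro order_trans[OF sum_abs] sum_mono)
    fix i show "\<bar>mpow p (toep m r) k i i - ?c\<bar> \<le> ?K ^ k + \<bar>?c\<bar>"
      using mpow_toep_bound[of p m r k i i] abs_triangle_ineq4[of "mpow p (toep m r) k i i" ?c] by linarith
  qed
  also have "\<dots> = real (card ({..<p} \<inter> ?B)) * (?K ^ k + \<bar>?c\<bar>)" by simp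
  also have "\<dots> \<le> 2 * real (k * m) * (?K ^ k + \<bar>?c\<bar>)"
  proof (rule mult_right_mono)
    have "card ({..<p} \<inter> ?B) \<le> card ?B" by (intro card_mono) auto
    also have "\<dots> \<le> card {..<k * m} + card {p - k * m..<p}" by (rule card_Un_le)
    also have "\<dots> \<le> 2 * (k * m)" by simp
    finally show "real (card ({..<p} \<inter> ?B)) \<le> 2 * real (k * m)" by linarith
    show "0 \<le> ?K ^ k + \<bar>?c\<bar>" by (intro add_nonneg_nonneg zero_le_power sum_nonneg) auto
  qed
  finally show ?thesis .
qed

lemma trace_mpow_toep_tendsto:
  "(\<lambda>p. (\<Sum>i<p. mpow p (toep m r) k i i) / real p) \<longlonglongrightarrow> conv_pow m r k 0"
proof -
  define C where "C = 2 * real (k * m) * ((\<Sum>s\<in>{-int m..int m}. \<bar>r s\<bar>) ^ k + \<bar>conv_pow m r k 0\<bar>)"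
  have "(\<lambda>p. (\<Sum>i<p. mpow p (toep m r) k i i) / real p - conv_pow m r k 0) \<longlonglongrightarrow> 0"
  proof (rule Lim_null_comparison)
    show "\<forall>\<^sub>F p in sequentially. norm ((\<Sum>i<p. mpow p (toep m r) k i i) / real p - conv_pow m r k 0) \<le> C / real p"
      using eventually_gt_at_top[of 0]
    proof eventually_elim
      case (elim p)
      have "norm ((\<Sum>i<p. mpow p (toep m r) k i i) / real p - conv_pow m r k 0)
        = \<bar>(\<Sum>i<p. mpow p (toep m r) k i i) - real p * conv_pow m r k 0\<bar> / real p"
      proof -
        have "(\<Sum>i<p. mpow p (toep m r) k i i) / real p - conv_pow m r k 0
          = ((\<Sum>i<p. mpow p (toep m r) k i i) - real p * conv_pow m r k 0) / real p"
          using elim by (simp add: field_simps)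
        thus ?thesis by (simp add: abs_divide)
      qed
      also have "\<dots> \<le> C / real p" unfolding C_def by (intro divide_right_mono trace_mpow_toep) auto
      finally show ?case .
    qed
    show "(\<lambda>p. C / real p) \<longlonglongrightarrow> 0" by (rule lim_const_over_n)
  qed
  thus ?thesis by (simp add: LIM_zero_iff)
qed

section \<open>Fourier coefficients of powers of the symbol, and the limit of Toeplitz
  spectra\<close>

lemma has_integral_cos_int:
  "((\<lambda>\<theta>. cos (2 * pi * of_int l * \<theta>)) has_integral of_bool (l = 0)) {0..1::real}"
proof (cases "l = 0")
  case True
  thus ?thesis using has_integral_const_real[of "1::real" 0 1] by simp
next
  case False
  have "((\<lambda>\<theta>. cos (2 * pi * of_int l * \<theta>)) has_integral
      (sin (2 * pi * of_int l * 1) / (2 * pi * of_int l) - sin (2 * pi * of_int l * 0) / (2 * pi * of_int l))) {0..1::real}"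
  proof (rule fundamental_theorem_of_calculus)
    fix x :: real
    show "((\<lambda>\<theta>. sin (2 * pi * of_int l * \<theta>) / (2 * pi * of_int l)) has_vector_derivative cos (2 * pi * of_int l * x)) (at x within {0..1})"
      using False unfolding has_real_derivative_iff_has_vector_derivative[symmetric]
      by (auto intro!: derivative_eq_intros)
  qed simp
  moreover have "sin (2 * pi * of_int l) = 0" using sin_int_2pin[of l] by (simp add: mult_ac)
  ultimately show ?thesis using False by simp
qed

text \<open>Multiplying by the symbol convolves the Fourier coefficients with \<open>r\<close>. The
  frequency \<open>l\<close> stays free because the induction step shifts it by every
  \<open>s\<close>.\<close>

lemma has_integral_trig_power_cos:
  assumes sym: "\<And>s. r (- s) = r s"
  shows "((\<lambda>\<theta>. trig m r \<theta> ^ k * cos (2 * pi * of_int l * \<theta>)) has_integral conv_pow m r k l) {0..1}"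
proof (induction k arbitrary: l)
  case 0
  show ?case using has_integral_cos_int[of l] by simp
next
  case (Suc k)
  have "((\<lambda>\<theta>. \<Sum>s\<in>{-int m..int m}. r s * (trig m r \<theta> ^ k * cos (2 * pi * of_int (l - s) * \<theta>)))
      has_integral conv_pow m r (Suc k) l) {0..1}"
    unfolding conv_pow.simps by (intro has_integral_sum has_integral_mult_right Suc) auto
  moreover have "(\<Sum>s\<in>{-int m..int m}. r s * (trig m r \<theta> ^ k * cos (2 * pi * of_int (l - s) * \<theta>)))
     = trig m r \<theta> ^ Suc k * cos (2 * pi * of_int l * \<theta>)" for \<theta>
  proof -
    \<comment> \<open>The sine terms at \<open>s\<close> and \<open>-s\<close> cancel, so the
      addition formula leaves only products of cosines.\<close>
    have odd: "(\<Sum>s\<in>{-int m..int m}. r s * sin (2 * pi * of_int s * \<theta>)) = 0"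
    proof -
      have "(\<Sum>s\<in>{-int m..int m}. r s * sin (2 * pi * of_int s * \<theta>))
          = (\<Sum>s\<in>{-int m..int m}. - (r s * sin (2 * pi * of_int s * \<theta>)))"
        by (rule sum.reindex_bij_witness[of _ uminus uminus]) (auto simp: sym)
      thus ?thesis by (simp add: sum_negf)
    qed
    have "(\<Sum>s\<in>{-int m..int m}. r s * (trig m r \<theta> ^ k * cos (2 * pi * of_int (l - s) * \<theta>)))
      = (\<Sum>s\<in>{-int m..int m}. trig m r \<theta> ^ k * cos (2 * pi * of_int l * \<theta>) * (r s * cos (2 * pi * of_int s * \<theta>))
          + trig m r \<theta> ^ k * sin (2 * pi * of_int l * \<theta>) * (r s * sin (2 * pi * of_int s * \<theta>)))"
    proof (intro sum.cong refl)
      fix s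
      have "2 * pi * of_int (l - s) * \<theta> = 2 * pi * of_int l * \<theta> - 2 * pi * of_int s * \<theta>"
        by (simp add: algebra_simps)
      hence *: "cos (2 * pi * of_int (l - s) * \<theta>) = cos (2 * pi * of_int l * \<theta>) * cos (2 * pi * of_int s * \<theta>)
          + sin (2 * pi * of_int l * \<theta>) * sin (2 * pi * of_int s * \<theta>)" by (simp only: cos_diff)
      show "r s * (trig m r \<theta> ^ k * cos (2 * pi * of_int (l - s) * \<theta>)) =
         trig m r \<theta> ^ k * cos (2 * pi * of_int l * \<theta>) * (r s * cos (2 * pi * of_int s * \<theta>))
          + trig m r \<theta> ^ k * sin (2 * pi * of_int l * \<theta>) * (r s * sin (2 * pi * of_int s * \<theta>))"
        unfolding * by (simp only: algebra_simps)
    qed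
    also have "\<dots> = trig m r \<theta> ^ k * cos (2 * pi * of_int l * \<theta>) * trig m r \<theta>"
      by (simp add: sum.distrib odd trig_def flip: sum_distrib_left)
    finally show ?thesis by (simp only: power_Suc mult_ac)
  qed
  ultimately show ?case by simp
qed

lemma polynomial_approx:
  fixes f :: "real \<Rightarrow> real"
  assumes "continuous_on UNIV f" "\<epsilon> > 0"
  obtains a N where "\<And>x. \<bar>x\<bar> \<le> K \<Longrightarrow> \<bar>f x - (\<Sum>k\<le>(N::nat). a k * x ^ k)\<bar> < \<epsilon>"
proof -
  obtain g where g: "real_polynomial_function g" "\<And>x. x \<in> {-K..K} \<Longrightarrow> \<bar>f x - g x\<bar> < \<epsilon>"
    by (rule Stone_Weierstrass_real_polynomial_function[of "{-K..K}" f \<epsilon>])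
      (use assms in \<open>auto intro: continuous_on_subset\<close>)
  then obtain a N where "g = (\<lambda>x. \<Sum>k\<le>(N::nat). a k * x ^ k)"
    using real_polynomial_function_imp_sum by blast
  thus ?thesis using g(2) that[of a N] by (auto simp: abs_le_iff)
qed

text \<open>Szego's limit theorem for a banded symbol. Eigenvalues and symbol values lie in
  \<open>[-K, K]\<close> for all \<open>p\<close>, so \<open>f\<close> can be replaced there by a
  polynomial, and polynomial averages of eigenvalues are combinations of normalised traces.\<close>

lemma toep_eigenvalues_tendsto:
  fixes f :: "real \<Rightarrow> real"
  assumes sym: "\<And>s. r (- s) = r s" and f: "continuous_on UNIV f"
    and T: "\<And>p. spectral_decomp p (toep m r) (e p) (v p)"
  shows "(\<lambda>p. (\<Sum>i<p. f (e p i)) / real p) \<longlonglongrightarrow> integral {0..1} (\<lambda>\<theta>. f (trig m r \<theta>))"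
proof (rule LIMSEQ_I)
  fix \<epsilon> :: real assume \<epsilon>: "\<epsilon> > 0"
  define K where "K = (\<Sum>s\<in>{-int m..int m}. \<bar>r s\<bar>)"
  obtain a N where q: "\<And>x. \<bar>x\<bar> \<le> K \<Longrightarrow> \<bar>f x - (\<Sum>k\<le>(N::nat). a k * x ^ k)\<bar> < \<epsilon> / 3"
    using polynomial_approx[OF f, of "\<epsilon> / 3" K] \<epsilon> by auto
  define q where "q x = (\<Sum>k\<le>N. a k * x ^ k)" for x :: real
  \<comment> \<open>Plays two parts: the limit of the averages of \<open>q\<close> over the
    eigenvalues, and the integral of \<open>q\<close> composed with the symbol.\<close>
  define c where "c = (\<Sum>k\<le>N. a k * conv_pow m r k 0)"
  have e: "\<bar>e p i\<bar> \<le> K" if "i < p" for p i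
  proof (rule spectral_decomp_eigenvalue_bound[OF T _ that])
    fix b
    have "(\<Sum>a<p. \<bar>toep m r a b\<bar>) = (\<Sum>a<p. \<bar>toep m r b a\<bar>)"
      by (simp add: toep_sym[of r m _ b, OF sym])
    thus "(\<Sum>a<p. \<bar>toep m r a b\<bar>) \<le> K" using toep_abs_row_sum[of m r b p] by (simp add: K_def)
  qed
  have "(\<lambda>p. \<Sum>k\<le>N. a k * ((\<Sum>i<p. mpow p (toep m r) k i i) / real p)) \<longlonglongrightarrow> c"
    unfolding c_def by (intro tendsto_intros trace_mpow_toep_tendsto)
  moreover have "(\<Sum>k\<le>N. a k * ((\<Sum>i<p. mpow p (toep m r) k i i) / real p)) = (\<Sum>i<p. q (e p i)) / real p" for p
    unfolding trace_mpow[OF T] q_def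
    by (subst sum.swap) (simp add: sum_distrib_left sum_divide_distrib)
  ultimately have "(\<lambda>p. (\<Sum>i<p. q (e p i)) / real p) \<longlonglongrightarrow> c" by simp
  from LIMSEQ_D[OF this, of "\<epsilon> / 3"] \<epsilon>
  obtain p0 where p0: "\<And>p. p \<ge> p0 \<Longrightarrow> \<bar>(\<Sum>i<p. q (e p i)) / real p - c\<bar> < \<epsilon> / 3"
    by (auto simp: real_norm_def)
  have "((\<lambda>\<theta>. \<Sum>k\<le>N. a k * (trig m r \<theta> ^ k * cos (2 * pi * of_int 0 * \<theta>))) has_integral c) {0..1}"
    unfolding c_def by (intro has_integral_sum has_integral_mult_right has_integral_trig_power_cos sym) auto
  hence qi: "((\<lambda>\<theta>. q (trig m r \<theta>)) has_integral c) {0..1}" by (simp add: q_def)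
  have fi: "(\<lambda>\<theta>. f (trig m r \<theta>)) integrable_on {0..1}"
    by (intro integrable_continuous_interval continuous_on_compose2[OF f continuous_on_trig]) auto
  have "norm (integral {0..1} (\<lambda>\<theta>. f (trig m r \<theta>) - q (trig m r \<theta>))) \<le> (\<epsilon> / 3) * (1 - 0)"
  proof (rule integral_bound)
    have cq: "continuous_on UNIV q" unfolding q_def by (intro continuous_intros)
    show "continuous_on {0..1} (\<lambda>\<theta>. f (trig m r \<theta>) - q (trig m r \<theta>))"
      by (intro continuous_on_diff continuous_on_compose2[OF f continuous_on_trig]
          continuous_on_compose2[OF cq continuous_on_trig]) auto
    show "\<And>t. t \<in> {0..1} \<Longrightarrow> norm (f (trig m r t) - q (trig m r t)) \<le> \<epsilon> / 3"
      using q abs_trig_le[of m r] unfolding q_def K_def by (auto intro: less_imp_le)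
  qed simp
  moreover have "integral {0..1} (\<lambda>\<theta>. f (trig m r \<theta>) - q (trig m r \<theta>)) = integral {0..1} (\<lambda>\<theta>. f (trig m r \<theta>)) - c"
    using qi fi by (simp add: integral_diff integral_unique has_integral_integrable)
  ultimately have fc: "\<bar>integral {0..1} (\<lambda>\<theta>. f (trig m r \<theta>)) - c\<bar> \<le> \<epsilon> / 3" by simp
  show "\<exists>no. \<forall>p\<ge>no. norm ((\<Sum>i<p. f (e p i)) / real p - integral {0..1} (\<lambda>\<theta>. f (trig m r \<theta>))) < \<epsilon>"
  proof (intro exI allI impI)
    fix p assume p: "p \<ge> max 1 p0"
    have "\<bar>(\<Sum>i<p. f (e p i)) - (\<Sum>i<p. q (e p i))\<bar> \<le> (\<Sum>i<p. \<epsilon> / 3)"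
      unfolding sum_subtractf[symmetric]
      by (intro order_trans[OF sum_abs] sum_mono) (use q e in \<open>auto simp: q_def intro: less_imp_le\<close>)
    hence "\<bar>(\<Sum>i<p. f (e p i)) / real p - (\<Sum>i<p. q (e p i)) / real p\<bar> \<le> \<epsilon> / 3"
      using p by (simp add: field_simps flip: diff_divide_distrib)
    with p0[of p] fc p show "norm ((\<Sum>i<p. f (e p i)) / real p - integral {0..1} (\<lambda>\<theta>. f (trig m r \<theta>))) < \<epsilon>"
      unfolding real_norm_def by linarith
  qed
qed

section \<open>The second joint cumulant\<close>

text \<open>The estimate \<open>|cis x - 1 - i x| \<le> x^2 / 2\<close>, integrated against the norm
  of \<open>W\<close>, leaves a remainder of order \<open>u^2\<close>. The weight \<open>W\<close>
  lets one statement cover every derivative of a characteristic function taken below.\<close>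

lemma has_vector_derivative_integral_cis:
  fixes Y :: "'a \<Rightarrow> real" and W :: "'a \<Rightarrow> complex"
  assumes Y: "Y \<in> borel_measurable M" and W: "integrable M W"
    and WY: "integrable M (\<lambda>\<omega>. W \<omega> * of_real (Y \<omega>))"
    and WY2: "integrable M (\<lambda>\<omega>. norm (W \<omega>) * (Y \<omega>)\<^sup>2)"
  shows "((\<lambda>u. \<integral>\<omega>. W \<omega> * cis (u * Y \<omega>) \<partial>M) has_vector_derivative
    (\<i> * (\<integral>\<omega>. W \<omega> * of_real (Y \<omega>) \<partial>M))) (at 0)"
proof -
  let ?F = "\<lambda>u. \<integral>\<omega>. W \<omega> * cis (u * Y \<omega>) \<partial>M"
  let ?D = "\<i> * (\<integral>\<omega>. W \<omega> * of_real (Y \<omega>) \<partial>M)"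
  define K where "K = (\<integral>\<omega>. norm (W \<omega>) * (Y \<omega>)\<^sup>2 \<partial>M)"
  have Wm: "W \<in> borel_measurable M" using W by auto
  have cism: "(\<lambda>\<omega>. cis (u * Y \<omega>)) \<in> borel_measurable M" for u
    unfolding cis_conv_exp using Y by measurable
  have int: "integrable M (\<lambda>\<omega>. W \<omega> * cis (u * Y \<omega>))" for u
    by (rule Bochner_Integration.integrable_bound[OF W]) (use Wm cism in \<open>auto simp: norm_mult\<close>)
  have K0: "K \<ge> 0" unfolding K_def by (rule Bochner_Integration.integral_nonneg) auto
  have bound: "norm (?F u - ?F 0 - u *\<^sub>R ?D) \<le> K * u\<^sup>2" for u
  proof -
    have "?F u - ?F 0 - u *\<^sub>R ?D = (\<integral>\<omega>. W \<omega> * (cis (u * Y \<omega>) - 1 - \<i> * of_real (u * Y \<omega>)) \<partial>M)"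
    proof -
      have "(\<integral>\<omega>. W \<omega> * (cis (u * Y \<omega>) - 1 - \<i> * of_real (u * Y \<omega>)) \<partial>M)
        = (\<integral>\<omega>. W \<omega> * cis (u * Y \<omega>) - W \<omega> - (\<i> * of_real u) * (W \<omega> * of_real (Y \<omega>)) \<partial>M)"
        by (intro Bochner_Integration.integral_cong refl) (simp add: algebra_simps)
      also have "\<dots> = ?F u - (\<integral>\<omega>. W \<omega> \<partial>M) - (\<i> * of_real u) * (\<integral>\<omega>. W \<omega> * of_real (Y \<omega>) \<partial>M)"
        using int[of u] W WY by (simp del: mult.assoc)
      finally show ?thesis by (simp add: scaleR_conv_of_real mult_ac)
    qed
    also have "norm \<dots> \<le> (\<integral>\<omega>. u\<^sup>2 * (norm (W \<omega>) * (Y \<omega>)\<^sup>2) \<partial>M)"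
    proof (intro order_trans[OF integral_norm_bound] integral_mono integrable_norm)
      show "integrable M (\<lambda>\<omega>. W \<omega> * (cis (u * Y \<omega>) - 1 - \<i> * of_real (u * Y \<omega>)))"
      proof -
        have "integrable M (\<lambda>\<omega>. W \<omega> * cis (u * Y \<omega>) - W \<omega> - (\<i> * of_real u) * (W \<omega> * of_real (Y \<omega>)))"
          by (intro Bochner_Integration.integrable_diff int W integrable_mult_right WY)
        thus ?thesis by (simp add: algebra_simps)
      qed
      show "integrable M (\<lambda>\<omega>. u\<^sup>2 * (norm (W \<omega>) * (Y \<omega>)\<^sup>2))" using WY2 by simp
      fix \<omega>
      have "cmod (iexp (u * Y \<omega>) - (\<Sum>k\<le>1. (\<i> * of_real (u * Y \<omega>))^k / fact k)) \<le> \<bar>u * Y \<omega>\<bar>^(Suc 1) / fact (Suc 1)"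
        by (rule iexp_approx1)
      hence "cmod (cis (u * Y \<omega>) - 1 - \<i> * of_real (u * Y \<omega>)) \<le> (u * Y \<omega>)\<^sup>2 / 2"
        by (simp add: cis_conv_exp diff_diff_eq power2_eq_square)
      also have "\<dots> \<le> u\<^sup>2 * (Y \<omega>)\<^sup>2" by (simp add: power_mult_distrib)
      finally show "norm (W \<omega> * (cis (u * Y \<omega>) - 1 - \<i> * of_real (u * Y \<omega>))) \<le> u\<^sup>2 * (norm (W \<omega>) * (Y \<omega>)\<^sup>2)"
        unfolding norm_mult by (metis mult.left_commute mult_left_mono norm_ge_zero)
    qed
    also have "\<dots> = K * u\<^sup>2" by (simp add: K_def)
    finally show ?thesis .
  qed
  have "((\<lambda>u. (?F u - ?F 0 - (u - 0) *\<^sub>R ?D) /\<^sub>R norm (u - 0)) \<longlongrightarrow> 0) (at 0)"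
  proof (rule Lim_null_comparison)
    show "\<forall>\<^sub>F u in at 0. norm ((?F u - ?F 0 - (u - 0) *\<^sub>R ?D) /\<^sub>R norm (u - 0)) \<le> K * \<bar>u\<bar>"
    proof (rule always_eventually, rule allI)
      fix u :: real
      show "norm ((?F u - ?F 0 - (u - 0) *\<^sub>R ?D) /\<^sub>R norm (u - 0)) \<le> K * \<bar>u\<bar>"
      proof (cases "u = 0")
        case False
        have "norm ((?F u - ?F 0 - (u - 0) *\<^sub>R ?D) /\<^sub>R norm (u - 0)) = norm (?F u - ?F 0 - u *\<^sub>R ?D) / \<bar>u\<bar>"
          by (simp add: divide_inverse mult.commute)
        also have "\<dots> \<le> (K * u\<^sup>2) / \<bar>u\<bar>" using bound[of u] by (intro divide_right_mono) auto
        also have "\<dots> = K * \<bar>u\<bar>" using False by (simp add: power2_eq_square abs_if)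
        finally show ?thesis .
      qed simp
    qed
    show "((\<lambda>u. K * \<bar>u\<bar>) \<longlongrightarrow> 0) (at 0)"
      by (auto intro!: tendsto_eq_intros)
  qed
  thus ?thesis
    unfolding has_vector_derivative_def has_derivative_def
    by (auto simp: bounded_linear_scaleR_left diff_diff_eq inverse_eq_divide)
qed

text \<open>Differentiating the logarithm in the second variable along the first axis gives
  \<open>i * \<psi> / \<phi>\<close>, with \<open>\<phi>\<close> the characteristic function of
  \<open>X\<close> and \<open>\<psi>\<close> its analogue weighted by \<open>Y\<close>. Its
  derivative at zero is the negative covariance, and the factor \<open>(-i)^2\<close> restores the
  sign. The moment of \<open>|Y| X^2\<close> controls the remainder in the derivative of
  \<open>\<psi>\<close>.\<close>

lemma (in prob_space) cumulant_pair_eq_cov: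
  fixes X Y :: "'a \<Rightarrow> real"
  assumes X: "X \<in> borel_measurable M" and Y: "Y \<in> borel_measurable M"
    and X2: "integrable M (\<lambda>\<omega>. (X \<omega>)\<^sup>2)" and Y2: "integrable M (\<lambda>\<omega>. (Y \<omega>)\<^sup>2)"
    and YX2: "integrable M (\<lambda>\<omega>. \<bar>Y \<omega>\<bar> * (X \<omega>)\<^sup>2)"
  shows "cumulant M [X, Y] = of_real (expectation (\<lambda>\<omega>. X \<omega> * Y \<omega>) - expectation X * expectation Y)"
proof -
  have X1: "integrable M X" by (rule square_integrable_imp_integrable[OF X X2])
  have Y1: "integrable M Y" by (rule square_integrable_imp_integrable[OF Y Y2])
  have XY: "integrable M (\<lambda>\<omega>. X \<omega> * Y \<omega>)"
  proof (rule Bochner_Integration.integrable_bound)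
    show "integrable M (\<lambda>\<omega>. (X \<omega>)\<^sup>2 + (Y \<omega>)\<^sup>2)" using X2 Y2 by simp
    show "AE x in M. norm (X x * Y x) \<le> norm ((X x)\<^sup>2 + (Y x)\<^sup>2)"
    proof (rule AE_I2)
      fix x
      have "0 \<le> (\<bar>X x\<bar> - \<bar>Y x\<bar>)\<^sup>2" by simp
      also have "\<dots> = (X x)\<^sup>2 + (Y x)\<^sup>2 - 2 * (\<bar>X x\<bar> * \<bar>Y x\<bar>)" by (simp add: power2_diff)
      finally have "2 * (\<bar>X x\<bar> * \<bar>Y x\<bar>) \<le> (X x)\<^sup>2 + (Y x)\<^sup>2" by simp
      moreover have "0 \<le> \<bar>X x\<bar> * \<bar>Y x\<bar>" by simp
      ultimately have "\<bar>X x\<bar> * \<bar>Y x\<bar> \<le> (X x)\<^sup>2 + (Y x)\<^sup>2" by linarith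
      thus "norm (X x * Y x) \<le> norm ((X x)\<^sup>2 + (Y x)\<^sup>2)" by (simp add: abs_mult)
    qed
  qed (use X Y in measurable)
  have [measurable]: "(\<lambda>\<omega>. cis (s * X \<omega>)) \<in> borel_measurable M" for s
    unfolding cis_conv_exp using X by measurable
  note [measurable] = X Y
  define \<phi> where "\<phi> s = (\<integral>\<omega>. cis (s * X \<omega>) \<partial>M)" for s
  define \<psi> where "\<psi> s = (\<integral>\<omega>. of_real (Y \<omega>) * cis (s * X \<omega>) \<partial>M)" for s
  have cisint: "integrable M (\<lambda>\<omega>. cis (s * X \<omega>))" for s
    by (rule integrable_const_bound[where B = 1]) auto
  have d\<phi>: "(\<phi> has_vector_derivative (\<i> * of_real (expectation X))) (at 0)"
    using has_vector_derivative_integral_cis[OF X, of "\<lambda>_. 1"] X1 X2 unfolding \<phi>_def by simp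
  have d\<psi>: "(\<psi> has_vector_derivative (\<i> * of_real (expectation (\<lambda>\<omega>. X \<omega> * Y \<omega>)))) (at 0)"
  proof -
    have "integrable M (\<lambda>\<omega>. complex_of_real (Y \<omega>) * of_real (X \<omega>))"
      using integrable_of_real[OF XY, where 'a = complex] by (simp add: mult.commute)
    moreover have "(\<integral>\<omega>. complex_of_real (Y \<omega>) * of_real (X \<omega>) \<partial>M) = of_real (expectation (\<lambda>\<omega>. X \<omega> * Y \<omega>))"
      by (simp flip: of_real_mult integral_of_real add: mult.commute)
    ultimately show ?thesis
      using has_vector_derivative_integral_cis[OF X, of "\<lambda>\<omega>. of_real (Y \<omega>)"] Y1 YX2 unfolding \<psi>_def by simp
  qed
  have \<phi>0: "\<phi> 0 = 1" by (simp add: \<phi>_def prob_space)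
  have \<psi>0: "\<psi> 0 = of_real (expectation Y)" by (simp add: \<psi>_def)
  have cont: "isCont \<phi> 0" using d\<phi> has_vector_derivative_continuous by blast
  \<comment> \<open>For such \<open>s\<close> the value \<open>\<phi> s\<close> has positive real
    part, hence stays away from the branch cut of \<open>Ln\<close>.\<close>
  have near: "\<forall>\<^sub>F s in nhds 0. norm (\<phi> s - 1) < 1"
    using tendstoD[OF cont[unfolded isCont_def], of 1] by (simp add: eventually_nhds_conv_at dist_norm \<phi>0)
  have jc: "joint_char_fun M [X, Y] t = (\<integral>\<omega>. cis (t 0 * X \<omega>) * cis (t 1 * Y \<omega>) \<partial>M)" for t
    unfolding joint_char_fun_def by (simp add: cis_mult numeral_2_eq_2)
  have inner: "iter_pderiv [1] (\<lambda>t. Ln (joint_char_fun M [X, Y] t)) ((\<lambda>_. 0)(0 := s)) = \<i> * \<psi> s / \<phi> s"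
    if s: "norm (\<phi> s - 1) < 1" for s
  proof -
    let ?G = "\<lambda>u. \<integral>\<omega>. cis (s * X \<omega>) * cis (u * Y \<omega>) \<partial>M"
    have *: "(?G has_vector_derivative (\<i> * \<psi> s)) (at 0)"
    proof -
      have "integrable M (\<lambda>\<omega>. cis (s * X \<omega>) * of_real (Y \<omega>))"
        by (rule Bochner_Integration.integrable_bound[OF Y1]) (auto simp: norm_mult)
      thus ?thesis
        using has_vector_derivative_integral_cis[OF Y cisint[of s]] Y2 by (simp add: \<psi>_def mult.commute)
    qed
    have G0: "?G 0 = \<phi> s" by (simp add: \<phi>_def)
    have "\<phi> s \<notin> \<real>\<^sub>\<le>\<^sub>0"
    proof
      assume "\<phi> s \<in> \<real>\<^sub>\<le>\<^sub>0"
      hence "Re (\<phi> s) \<le> 0" by (auto simp: complex_nonpos_Reals_iff)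
      hence "1 \<le> \<bar>Re (\<phi> s - 1)\<bar>" by simp
      also have "\<dots> \<le> norm (\<phi> s - 1)" by (rule abs_Re_le_cmod)
      finally show False using s by simp
    qed
    hence "((\<lambda>u. Ln (?G u)) has_vector_derivative (\<i> * \<psi> s * (1 / \<phi> s))) (at 0)"
      using field_vector_diff_chain_at[OF *, of Ln "inverse (\<phi> s)"] has_field_derivative_Ln[of "\<phi> s"] G0
      by (simp add: o_def divide_inverse)
    hence "vector_derivative (\<lambda>u. Ln (?G u)) (at 0) = \<i> * \<psi> s / \<phi> s"
      by (simp add: vector_derivative_at)
    thus ?thesis by (simp add: jc)
  qed
  have "((\<lambda>s. \<i> * \<psi> s / \<phi> s) has_vector_derivative
      (expectation X * expectation Y - expectation (\<lambda>\<omega>. X \<omega> * Y \<omega>))) (at 0)"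
  proof -
    have "((\<lambda>s. \<i> * \<psi> s / \<phi> s) has_derivative
      (\<lambda>h. (h *\<^sub>R (\<i> * (\<i> * of_real (expectation (\<lambda>\<omega>. X \<omega> * Y \<omega>)))) * \<phi> 0 
         - (\<i> * \<psi> 0) * (h *\<^sub>R (\<i> * of_real (expectation X)))) / (\<phi> 0 * \<phi> 0))) (at 0)"
      by (rule has_derivative_divide') 
        (use d\<phi> has_vector_derivative_mult_right[OF d\<psi>, of \<i>] \<phi>0 in \<open>auto simp: has_vector_derivative_def\<close>)
    thus ?thesis unfolding has_vector_derivative_def
      by (simp add: \<phi>0 \<psi>0 scaleR_conv_of_real algebra_simps)
  qed
  \<comment> \<open>The formula for the inner derivative is known only near zero, so it is
    transferred through equality of the two functions on a neighbourhood.\<close>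
  hence "((\<lambda>s. iter_pderiv [1] (\<lambda>t. Ln (joint_char_fun M [X, Y] t)) ((\<lambda>_. 0)(0 := s))) has_vector_derivative
      (expectation X * expectation Y - expectation (\<lambda>\<omega>. X \<omega> * Y \<omega>))) (at 0)"
    by (subst has_vector_derivative_cong_ev[where g = "\<lambda>s. \<i> * \<psi> s / \<phi> s"])
      (use near inner[of 0] \<phi>0 in \<open>auto elim!: eventually_mono dest: inner\<close>)
  hence "iter_pderiv [0, 1] (\<lambda>t. Ln (joint_char_fun M [X, Y] t)) (\<lambda>_. 0) =
      expectation X * expectation Y - expectation (\<lambda>\<omega>. X \<omega> * Y \<omega>)"
    unfolding iter_pderiv.simps(2)[of 0 "[1]"] by (rule vector_derivative_at)
  moreover have "[0..<length [X, Y]] = [0, 1]" by (simp add: upt_rec)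
  ultimately show ?thesis unfolding cumulant_def by simp
qed

section \<open>Sample covariances\<close>

lemma (in prob_space) indep_vars_cross_expectation:
  fixes W :: "'i \<Rightarrow> 'a \<Rightarrow> real"
  assumes ind: "indep_vars (\<lambda>_. borel) W UNIV" and int: "\<And>k. integrable M (W k)"
    and kl: "k \<noteq> l"
  shows "expectation (\<lambda>\<omega>. W k \<omega> * W l \<omega>) = expectation (W k) * expectation (W l)"
    and "integrable M (\<lambda>\<omega>. W k \<omega> * W l \<omega>)"
proof -
  have i: "indep_vars (\<lambda>_. borel) W {k, l}" by (rule indep_vars_subset[OF ind]) auto
  show "expectation (\<lambda>\<omega>. W k \<omega> * W l \<omega>) = expectation (W k) * expectation (W l)"
    using indep_vars_lebesgue_integral[OF _ i] int kl by simp
  show "integrable M (\<lambda>\<omega>. W k \<omega> * W l \<omega>)"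
    using indep_vars_integrable[OF _ i] int kl by simp
qed

text \<open>Variance plus squared bias. Off-diagonal products have expectation
  \<open>\<mu>\<^sup>2\<close> by independence, and the diagonal, where \<open>c\<close> is the
  bound, is a fraction \<open>1 / card I\<close> of all pairs. The target \<open>t\<close> is free
  because entries will be compared with a truncated covariance.\<close>

lemma (in prob_space) mean_square_deviation_of_mean:
  fixes W :: "'i \<Rightarrow> 'a \<Rightarrow> real"
  assumes ind: "indep_vars (\<lambda>_. borel) W UNIV" and int2: "\<And>k. integrable M (\<lambda>\<omega>. (W k \<omega>)\<^sup>2)"
    and mean: "\<And>k. expectation (W k) = \<mu>" and sq: "\<And>k. expectation (\<lambda>\<omega>. (W k \<omega>)\<^sup>2) \<le> c"
    and I: "finite I" "I \<noteq> {}"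
  shows "expectation (\<lambda>\<omega>. ((\<Sum>k\<in>I. W k \<omega>) / card I - t)\<^sup>2) \<le> c / card I + (\<mu> - t)\<^sup>2"
    and "integrable M (\<lambda>\<omega>. ((\<Sum>k\<in>I. W k \<omega>) / card I - t)\<^sup>2)"
proof -
  have meas: "W k \<in> borel_measurable M" for k using ind unfolding indep_vars_def2 by simp
  have int: "integrable M (W k)" for k by (rule square_integrable_imp_integrable[OF meas int2])
  have cross: "integrable M (\<lambda>\<omega>. W k \<omega> * W l \<omega>)" for k l
    using indep_vars_cross_expectation(2)[OF ind int, of k l] int2[of k] by (cases "k = l") (auto simp: power2_eq_square)
  have crossE: "expectation (\<lambda>\<omega>. W k \<omega> * W l \<omega>) \<le> \<mu>\<^sup>2 + (if k = l then c - \<mu>\<^sup>2 else 0)" for k l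
    using indep_vars_cross_expectation(1)[OF ind int, of k l] sq[of k] mean
    by (cases "k = l") (auto simp: power2_eq_square)
  define n where "n = real (card I)"
  have n: "n > 0" using I by (simp add: n_def card_gt_0_iff)
  have expand: "((\<Sum>k\<in>I. W k \<omega>) / n - t)\<^sup>2 = (\<Sum>k\<in>I. \<Sum>l\<in>I. W k \<omega> * W l \<omega>) / n\<^sup>2 - 2 * t / n * (\<Sum>k\<in>I. W k \<omega>) + t\<^sup>2" for \<omega>
    by (simp add: power2_diff power_divide flip: sum_product) (simp add: power2_eq_square)
  show "integrable M (\<lambda>\<omega>. ((\<Sum>k\<in>I. W k \<omega>) / card I - t)\<^sup>2)"
    unfolding n_def[symmetric] expand using cross int by (intro Bochner_Integration.integrable_add Bochner_Integration.integrable_diff) auto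
  have "expectation (\<lambda>\<omega>. ((\<Sum>k\<in>I. W k \<omega>) / n - t)\<^sup>2)
     = (\<Sum>k\<in>I. \<Sum>l\<in>I. expectation (\<lambda>\<omega>. W k \<omega> * W l \<omega>)) / n\<^sup>2 - 2 * t / n * (\<Sum>k\<in>I. expectation (W k)) + t\<^sup>2"
    unfolding expand using cross int by (simp add: prob_space)
  also have "(\<Sum>k\<in>I. expectation (W k)) = n * \<mu>" by (simp add: mean n_def)
  also have "(\<Sum>k\<in>I. \<Sum>l\<in>I. expectation (\<lambda>\<omega>. W k \<omega> * W l \<omega>)) \<le> (\<Sum>k\<in>I. \<Sum>l\<in>I. \<mu>\<^sup>2 + (if k = l then c - \<mu>\<^sup>2 else 0))"
    by (intro sum_mono crossE)
  also have "\<dots> = n\<^sup>2 * \<mu>\<^sup>2 + n * (c - \<mu>\<^sup>2)"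
    using I by (simp add: sum.distrib n_def power2_eq_square algebra_simps)
  finally have "expectation (\<lambda>\<omega>. ((\<Sum>k\<in>I. W k \<omega>) / n - t)\<^sup>2)
     \<le> (n\<^sup>2 * \<mu>\<^sup>2 + n * (c - \<mu>\<^sup>2)) / n\<^sup>2 - 2 * t / n * (n * \<mu>) + t\<^sup>2"
    using n by (simp add: divide_right_mono)
  also have "\<dots> = (c - \<mu>\<^sup>2) / n + (\<mu> - t)\<^sup>2"
    using n by (simp add: field_simps power2_eq_square)
  also have "\<dots> \<le> c / n + (\<mu> - t)\<^sup>2" using n by (simp add: divide_right_mono)
  finally show "expectation (\<lambda>\<omega>. ((\<Sum>k\<in>I. W k \<omega>) / card I - t)\<^sup>2) \<le> c / card I + (\<mu> - t)\<^sup>2"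
    by (simp add: n_def)
qed

lemma abs_mult_le_sum_squares: "2 * \<bar>x * y\<bar> \<le> x\<^sup>2 + y\<^sup>2" for x y :: real
proof -
  have "0 \<le> (\<bar>x\<bar> - \<bar>y\<bar>)\<^sup>2" by simp
  thus ?thesis by (simp add: power2_diff abs_mult)
qed

section \<open>Independent copies of a stationary process\<close>

locale iid_stationary_copies = prob_space M for M :: "'a measure" +
  fixes Zc :: "nat \<Rightarrow> int \<Rightarrow> 'a \<Rightarrow> real"
  assumes meas: "\<And>i j. Zc i j \<in> borel_measurable M"
    and indep: "indep_vars (\<lambda>_. PiM (UNIV :: int set) (\<lambda>_. borel)) (\<lambda>i \<omega>. \<lambda>j. Zc i j \<omega>) UNIV"
    and ident: "\<And>i. distr M (PiM (UNIV :: int set) (\<lambda>_. borel)) (\<lambda>\<omega> j. Zc i j \<omega>)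
                   = distr M (PiM (UNIV :: int set) (\<lambda>_. borel)) (\<lambda>\<omega> j. Zc 0 j \<omega>)"
    and stationary: "\<And>s. distr M (PiM (UNIV :: int set) (\<lambda>_. borel)) (\<lambda>\<omega> j. Zc 0 (j + s) \<omega>)
                   = distr M (PiM (UNIV :: int set) (\<lambda>_. borel)) (\<lambda>\<omega> j. Zc 0 j \<omega>)"
    and moments: "\<And>k::nat. integrable M (\<lambda>\<omega>. \<bar>Zc 0 0 \<omega>\<bar> ^ k)"
    and mean0: "expectation (Zc 0 0) = 0"
begin

abbreviation "process_space \<equiv> PiM (UNIV :: int set) (\<lambda>_. borel :: real measure)"

lemma process_measurable: "(\<lambda>\<omega> j. Zc i (j + s) \<omega>) \<in> measurable M process_space"
  by (rule measurable_PiM_single') (auto simp: meas)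

lemma process_measurable_unshifted: "(\<lambda>\<omega> j. Zc i j \<omega>) \<in> measurable M process_space"
  by (rule measurable_PiM_single') (auto simp: meas)

text \<open>The law of a shifted copy is the image of the unshifted law under the shift map.
  Identical distribution replaces copy \<open>i\<close> by copy zero, and stationarity then removes
  the shift.\<close>

lemma distr_shift: "distr M process_space (\<lambda>\<omega> j. Zc i (j + s) \<omega>) = distr M process_space (\<lambda>\<omega> j. Zc 0 j \<omega>)"
proof -
  have sh: "(\<lambda>z j. z (j + s)) \<in> measurable process_space process_space"
    by (rule measurable_PiM_single') auto
  have "distr M process_space (\<lambda>\<omega> j. Zc i (j + s) \<omega>) = distr (distr M process_space (\<lambda>\<omega> j. Zc i j \<omega>)) process_space (\<lambda>z j. z (j + s))"
    by (simp only: distr_distr[OF sh process_measurable_unshifted] o_def)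
  also have "\<dots> = distr (distr M process_space (\<lambda>\<omega> j. Zc 0 j \<omega>)) process_space (\<lambda>z j. z (j + s))" by (subst ident) (rule refl)
  also have "\<dots> = distr M process_space (\<lambda>\<omega> j. Zc 0 (j + s) \<omega>)"
    by (simp only: distr_distr[OF sh process_measurable_unshifted] o_def)
  also note stationary
  finally show ?thesis .
qed

lemma expectation_shift:
  fixes g :: "(int \<Rightarrow> real) \<Rightarrow> real"
  assumes g: "g \<in> borel_measurable process_space"
  shows "expectation (\<lambda>\<omega>. g (\<lambda>j. Zc i (j + s) \<omega>)) = expectation (\<lambda>\<omega>. g (\<lambda>j. Zc 0 j \<omega>))"
    and "integrable M (\<lambda>\<omega>. g (\<lambda>j. Zc i (j + s) \<omega>)) \<longleftrightarrow> integrable M (\<lambda>\<omega>. g (\<lambda>j. Zc 0 j \<omega>))"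
proof -
  have "expectation (\<lambda>\<omega>. g (\<lambda>j. Zc i (j + s) \<omega>)) = integral\<^sup>L (distr M process_space (\<lambda>\<omega> j. Zc i (j + s) \<omega>)) g"
    by (rule integral_distr[OF process_measurable g, symmetric])
  also have "\<dots> = expectation (\<lambda>\<omega>. g (\<lambda>j. Zc 0 j \<omega>))"
    unfolding distr_shift by (rule integral_distr[OF process_measurable_unshifted g])
  finally show "expectation (\<lambda>\<omega>. g (\<lambda>j. Zc i (j + s) \<omega>)) = expectation (\<lambda>\<omega>. g (\<lambda>j. Zc 0 j \<omega>))" .
  have "integrable M (\<lambda>\<omega>. g (\<lambda>j. Zc i (j + s) \<omega>)) \<longleftrightarrow> integrable (distr M process_space (\<lambda>\<omega> j. Zc i (j + s) \<omega>)) g"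
    by (rule integrable_distr_eq[OF process_measurable g, symmetric])
  also have "\<dots> \<longleftrightarrow> integrable M (\<lambda>\<omega>. g (\<lambda>j. Zc 0 j \<omega>))"
    unfolding distr_shift by (rule integrable_distr_eq[OF process_measurable_unshifted g])
  finally show "integrable M (\<lambda>\<omega>. g (\<lambda>j. Zc i (j + s) \<omega>)) \<longleftrightarrow> integrable M (\<lambda>\<omega>. g (\<lambda>j. Zc 0 j \<omega>))" .
qed

lemma expectation_single:
  fixes h :: "real \<Rightarrow> real"
  assumes h: "h \<in> borel_measurable borel"
  shows "expectation (\<lambda>\<omega>. h (Zc i j \<omega>)) = expectation (\<lambda>\<omega>. h (Zc 0 0 \<omega>))"
    and "integrable M (\<lambda>\<omega>. h (Zc i j \<omega>)) \<longleftrightarrow> integrable M (\<lambda>\<omega>. h (Zc 0 0 \<omega>))"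
proof -
  have g: "(\<lambda>z. h (z 0)) \<in> borel_measurable process_space"
    by (rule measurable_compose[OF _ h]) simp
  show "expectation (\<lambda>\<omega>. h (Zc i j \<omega>)) = expectation (\<lambda>\<omega>. h (Zc 0 0 \<omega>))"
    using expectation_shift(1)[OF g, of i j] by simp
  show "integrable M (\<lambda>\<omega>. h (Zc i j \<omega>)) \<longleftrightarrow> integrable M (\<lambda>\<omega>. h (Zc 0 0 \<omega>))"
    using expectation_shift(2)[OF g, of i j] by simp
qed

lemma expectation_pair:
  "expectation (\<lambda>\<omega>. Zc i j \<omega> * Zc i l \<omega>) = expectation (\<lambda>\<omega>. Zc 0 0 \<omega> * Zc 0 (l - j) \<omega>)"
proof -
  have "(\<lambda>z. z 0 * z (l - j)) \<in> borel_measurable process_space" by measurable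
  from expectation_shift(1)[OF this, of i j] show ?thesis by simp
qed

lemma integrable_power: "integrable M (\<lambda>\<omega>. (Zc i j \<omega>) ^ k)"
proof -
  have "integrable M (\<lambda>\<omega>. Zc 0 0 \<omega> ^ k)"
    by (rule Bochner_Integration.integrable_bound[OF moments[of k]]) (auto simp: power_abs intro!: borel_measurable_power meas)
  thus ?thesis using expectation_single(2)[of "\<lambda>x. x ^ k" i j] by simp
qed

lemma expectation_zero: "expectation (Zc i j) = 0"
  using expectation_single(1)[of "\<lambda>x. x" i j] mean0 by simp

lemma autocov_eq: "autocov M (Zc 0) j = expectation (\<lambda>\<omega>. Zc 0 0 \<omega> * Zc 0 j \<omega>)"
  by (simp add: autocov_def expectation_zero)

lemma expectation_pair_autocov: "expectation (\<lambda>\<omega>. Zc i j \<omega> * Zc i l \<omega>) = autocov M (Zc 0) (l - j)"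
  unfolding autocov_eq by (rule expectation_pair)

lemma autocov_minus: "autocov M (Zc 0) (- j) = autocov M (Zc 0) j"
proof -
  have "autocov M (Zc 0) (- j) = expectation (\<lambda>\<omega>. Zc 0 j \<omega> * Zc 0 0 \<omega>)"
    by (simp add: expectation_pair_autocov)
  also have "\<dots> = autocov M (Zc 0) j" by (simp add: autocov_eq mult.commute)
  finally show ?thesis .
qed

text \<open>The mixed third moment is reduced to single moments by
  \<open>|x y^2| \<le> x^2 + y^4\<close>; centering leaves the expectation of the product.\<close>

lemma cumulant_eq_autocov: "cumulant M [Zc 0 0, Zc 0 j] = of_real (autocov M (Zc 0) j)"
proof -
  have "integrable M (\<lambda>\<omega>. \<bar>Zc 0 j \<omega>\<bar> * (Zc 0 0 \<omega>)\<^sup>2)"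
  proof (rule Bochner_Integration.integrable_bound)
    show "integrable M (\<lambda>\<omega>. (Zc 0 j \<omega>)\<^sup>2 + (Zc 0 0 \<omega>) ^ 4)"
      by (intro Bochner_Integration.integrable_add integrable_power)
    show "AE \<omega> in M. norm (\<bar>Zc 0 j \<omega>\<bar> * (Zc 0 0 \<omega>)\<^sup>2) \<le> norm ((Zc 0 j \<omega>)\<^sup>2 + (Zc 0 0 \<omega>) ^ 4)"
    proof (rule AE_I2)
      fix \<omega>
      have "2 * \<bar>Zc 0 j \<omega> * (Zc 0 0 \<omega>)\<^sup>2\<bar> \<le> (Zc 0 j \<omega>)\<^sup>2 + ((Zc 0 0 \<omega>)\<^sup>2)\<^sup>2"
        by (rule abs_mult_le_sum_squares)
      moreover have "0 \<le> \<bar>Zc 0 j \<omega> * (Zc 0 0 \<omega>)\<^sup>2\<bar>" by simp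
      ultimately have "\<bar>Zc 0 j \<omega> * (Zc 0 0 \<omega>)\<^sup>2\<bar> \<le> (Zc 0 j \<omega>)\<^sup>2 + ((Zc 0 0 \<omega>)\<^sup>2)\<^sup>2" by linarith
      thus "norm (\<bar>Zc 0 j \<omega>\<bar> * (Zc 0 0 \<omega>)\<^sup>2) \<le> norm ((Zc 0 j \<omega>)\<^sup>2 + (Zc 0 0 \<omega>) ^ 4)"
        by (simp add: abs_mult)
    qed
  qed (use meas in measurable)
  from cumulant_pair_eq_cov[OF meas meas integrable_power integrable_power this]
  show ?thesis by (simp add: autocov_eq expectation_zero)
qed

definition fourth_moment :: real where "fourth_moment = expectation (\<lambda>\<omega>. Zc 0 0 \<omega> ^ 4)"

lemma fourth_moment_nonneg: "fourth_moment \<ge> 0" unfolding fourth_moment_def by (rule Bochner_Integration.integral_nonneg) auto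

text \<open>The square of a product is at most the mean of the two fourth powers, and both have
  expectation \<open>fourth_moment\<close> by stationarity. The bound is thus the same for every
  matrix entry.\<close>

lemma product_second_moment:
  "integrable M (\<lambda>\<omega>. (Zc i j \<omega> * Zc i l \<omega>)\<^sup>2)" "expectation (\<lambda>\<omega>. (Zc i j \<omega> * Zc i l \<omega>)\<^sup>2) \<le> fourth_moment"
proof -
  have le: "(x * y)\<^sup>2 \<le> (x ^ 4 + y ^ 4) / 2" for x y :: real
    using abs_mult_le_sum_squares[of "x\<^sup>2" "y\<^sup>2"] by (simp add: power_mult_distrib)
  have int: "integrable M (\<lambda>\<omega>. (Zc i j \<omega> ^ 4 + Zc i l \<omega> ^ 4) / 2)"
    using integrable_power by auto
  show *: "integrable M (\<lambda>\<omega>. (Zc i j \<omega> * Zc i l \<omega>)\<^sup>2)"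
    by (rule Bochner_Integration.integrable_bound[OF int])
      (use le meas in \<open>auto intro!: borel_measurable_power borel_measurable_times AE_I2\<close>)
  have "expectation (\<lambda>\<omega>. (Zc i j \<omega> * Zc i l \<omega>)\<^sup>2) \<le> expectation (\<lambda>\<omega>. (Zc i j \<omega> ^ 4 + Zc i l \<omega> ^ 4) / 2)"
    by (rule integral_mono[OF * int]) (rule le)
  also have "\<dots> = fourth_moment"
    using integrable_power[of i j 4] integrable_power[of i l 4]
      expectation_single(1)[of "\<lambda>x. x ^ 4" i j] expectation_single(1)[of "\<lambda>x. x ^ 4" i l]
    by (simp add: fourth_moment_def)
  finally show "expectation (\<lambda>\<omega>. (Zc i j \<omega> * Zc i l \<omega>)\<^sup>2) \<le> fourth_moment" .
qed

lemma indep_products: "indep_vars (\<lambda>_. borel) (\<lambda>k \<omega>. Zc k j \<omega> * Zc k l \<omega>) UNIV"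
  using indep_vars_compose2[OF indep, of "\<lambda>_ z. z j * z l" "\<lambda>_. borel"] by simp

lemma sample_cov_deviation:
  fixes n :: nat
  assumes "n > 0"
  shows "expectation (\<lambda>\<omega>. ((\<Sum>k\<in>{1..n}. Zc k j \<omega> * Zc k l \<omega>) / n - t)\<^sup>2) \<le> fourth_moment / n + (autocov M (Zc 0) (l - j) - t)\<^sup>2"
    and "integrable M (\<lambda>\<omega>. ((\<Sum>k\<in>{1..n}. Zc k j \<omega> * Zc k l \<omega>) / n - t)\<^sup>2)"
  using mean_square_deviation_of_mean[OF indep_products[of j l] product_second_moment(1)[of _ j l]
      expectation_pair_autocov[of _ j l] product_second_moment(2)[of _ j l], of "{1..n}" t] assms
  by auto

end

section \<open>Convergence of the empirical measure\<close>

text \<open>The eigenvalues \<open>d\<close> are merely chosen, with no measurability of their own.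
  Their power sums are traces, hence polynomials in the measurable entries, and \<open>f\<close> is
  a pointwise limit of polynomials.\<close>

lemma borel_measurable_sum_eigenvalues:
  fixes f :: "real \<Rightarrow> real"
  assumes A: "\<And>i j. i < p \<Longrightarrow> j < p \<Longrightarrow> (\<lambda>\<omega>. A \<omega> i j) \<in> borel_measurable M"
    and d: "\<And>\<omega>. spectral_decomp p (A \<omega>) (d \<omega>) (u \<omega>)" and f: "continuous_on UNIV f"
  shows "(\<lambda>\<omega>. \<Sum>i<p. f (d \<omega> i)) \<in> borel_measurable M"
proof -
  have mp: "(\<lambda>\<omega>. mpow p (A \<omega>) k i j) \<in> borel_measurable M" if "i < p" "j < p" for k i j
    using that
  proof (induction k arbitrary: i)
    case (Suc k)
    show ?case unfolding mpow.simps
      by (intro borel_measurable_sum borel_measurable_times A Suc) (use Suc.prems in auto)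
  qed simp
  have pw: "(\<lambda>\<omega>. \<Sum>i<p. d \<omega> i ^ k) \<in> borel_measurable M" for k
    unfolding trace_mpow[OF d, symmetric] by (intro borel_measurable_sum mp) auto
  \<comment> \<open>The \<open>n\<close>-th polynomial is accurate on \<open>[-n, n]\<close>, so at
    each fixed real number the approximation holds from some \<open>n\<close> on.\<close>
  have "\<forall>n. \<exists>a N. \<forall>x. \<bar>x\<bar> \<le> real n \<longrightarrow> \<bar>f x - (\<Sum>k\<le>(N::nat). a k * x ^ k)\<bar> < inverse (Suc n)"
  proof
    fix n
    show "\<exists>a N. \<forall>x. \<bar>x\<bar> \<le> real n \<longrightarrow> \<bar>f x - (\<Sum>k\<le>(N::nat). a k * x ^ k)\<bar> < inverse (Suc n)"
      by (rule polynomial_approx[OF f, of "inverse (Suc n)" "real n"]) auto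
  qed
  then obtain a N where aN: "\<And>n x. \<bar>x\<bar> \<le> real n \<Longrightarrow> \<bar>f x - (\<Sum>k\<le>N n. a n k * x ^ k)\<bar> < inverse (Suc n)"
    by metis
  show ?thesis
  proof (rule borel_measurable_LIMSEQ_real)
    show "(\<lambda>\<omega>. \<Sum>k\<le>N n. a n k * (\<Sum>i<p. d \<omega> i ^ k)) \<in> borel_measurable M" for n
      by (intro borel_measurable_sum borel_measurable_times pw) auto
    fix \<omega>
    have lim: "(\<lambda>n. \<Sum>k\<le>N n. a n k * x ^ k) \<longlonglongrightarrow> f x" for x
    proof -
      have "(\<lambda>n. (\<Sum>k\<le>N n. a n k * x ^ k) - f x) \<longlonglongrightarrow> 0"
      proof (rule Lim_null_comparison[OF _ LIMSEQ_inverse_real_of_nat])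
        obtain n0 where n0: "\<bar>x\<bar> \<le> real n0" using real_arch_simple by blast
        show "\<forall>\<^sub>F n in sequentially. norm ((\<Sum>k\<le>N n. a n k * x ^ k) - f x) \<le> inverse (real (Suc n))"
        proof (rule eventually_sequentiallyI[of n0])
          fix n assume "n0 \<le> n"
          hence "\<bar>x\<bar> \<le> real n" using n0 by linarith
          from aN[OF this] show "norm ((\<Sum>k\<le>N n. a n k * x ^ k) - f x) \<le> inverse (real (Suc n))"
            unfolding real_norm_def by linarith
        qed
      qed
      thus ?thesis by (simp add: LIM_zero_iff)
    qed
    have "(\<lambda>n. \<Sum>i<p. \<Sum>k\<le>N n. a n k * d \<omega> i ^ k) \<longlonglongrightarrow> (\<Sum>i<p. f (d \<omega> i))"
      by (intro tendsto_sum lim)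
    thus "(\<lambda>n. \<Sum>k\<le>N n. a n k * (\<Sum>i<p. d \<omega> i ^ k)) \<longlonglongrightarrow> (\<Sum>i<p. f (d \<omega> i))"
      by (subst (asm) sum.swap) (simp add: sum_distrib_left)
  qed
qed

text \<open>For \<open>x\<close> near \<open>y\<close> uniform continuity gives
  \<open>\<epsilon>\<close>; for \<open>x\<close> far from \<open>y\<close> the quadratic term
  exceeds the oscillation of \<open>f\<close>. Only \<open>y\<close> is confined to a compact set,
  in line with \<open>spectral_comparison\<close>.\<close>

lemma bounded_continuous_quadratic_bound:
  fixes f :: "real \<Rightarrow> real"
  assumes f: "continuous_on UNIV f" and B: "\<And>x. \<bar>f x\<bar> \<le> B" and \<epsilon>: "\<epsilon> > 0"
  obtains C where "C > 0" "\<And>x y. \<bar>y\<bar> \<le> K \<Longrightarrow> \<bar>f x - f y\<bar> \<le> \<epsilon> + C * (x - y)\<^sup>2"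
proof -
  \<comment> \<open>The margin of one on each side makes room for an \<open>x\<close> within
    distance \<open>\<delta> \<le> 1\<close> of \<open>y\<close>.\<close>
  have "uniformly_continuous_on {-K-1..K+1} f"
    by (intro compact_uniformly_continuous continuous_on_subset[OF f]) auto
  then obtain \<delta>0 where \<delta>0: "\<delta>0 > 0"
    "\<And>x y. x \<in> {-K-1..K+1} \<Longrightarrow> y \<in> {-K-1..K+1} \<Longrightarrow> dist x y < \<delta>0 \<Longrightarrow> dist (f x) (f y) < \<epsilon>"
    unfolding uniformly_continuous_on_def using \<epsilon> by metis
  define \<delta> where "\<delta> = min \<delta>0 1"
  have \<delta>: "\<delta> > 0" using \<delta>0 by (simp add: \<delta>_def)
  have B0: "B \<ge> 0" using B[of 0] by linarith
  \<comment> \<open>Chosen so that \<open>C * \<delta>\<^sup>2\<close> exceeds \<open>2 * B\<close>;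
    the added one keeps \<open>C\<close> positive if \<open>B = 0\<close>.\<close>
  define C where "C = (2 * B + 1) / \<delta>\<^sup>2"
  have C: "C > 0" using B0 \<delta> by (simp add: C_def)
  show ?thesis
  proof (rule that[OF C])
    fix x y :: real assume y: "\<bar>y\<bar> \<le> K"
    have C0: "0 \<le> C * (x - y)\<^sup>2" using C by simp
    show "\<bar>f x - f y\<bar> \<le> \<epsilon> + C * (x - y)\<^sup>2"
    proof (cases "\<bar>x - y\<bar> < \<delta>")
      case True
      hence "dist (f x) (f y) < \<epsilon>" using y by (intro \<delta>0(2)) (auto simp: \<delta>_def dist_real_def)
      thus ?thesis using C0 by (simp add: dist_real_def)
    next
      case False
      have "2 * B + 1 = C * \<delta>\<^sup>2" using \<delta> by (simp add: C_def)
      also have "\<dots> \<le> C * (x - y)\<^sup>2"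
        using False \<delta> C by (intro mult_left_mono) (auto simp: abs_le_square_iff[symmetric])
      finally show ?thesis using B[of x] B[of y] \<epsilon> by linarith
    qed
  qed
qed

section \<open>Truncation of the spectral density and the limit measure\<close>

lemma abs_summable_int_tail:
  fixes r :: "int \<Rightarrow> real"
  assumes "(\<lambda>s. \<bar>r s\<bar>) summable_on UNIV" and \<eta>: "\<eta> > 0"
  obtains m0 where "\<And>m F. m \<ge> m0 \<Longrightarrow> finite F \<Longrightarrow> F \<inter> {-int m..int m} = {} \<Longrightarrow> (\<Sum>s\<in>F. \<bar>r s\<bar>) \<le> \<eta>"
proof -
  obtain S where "((\<lambda>s. \<bar>r s\<bar>) has_sum S) UNIV" using assms(1) unfolding summable_on_def by blast
  hence "\<forall>\<^sub>F X in finite_subsets_at_top UNIV. dist (\<Sum>s\<in>X. \<bar>r s\<bar>) S < \<eta> / 2"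
    unfolding has_sum_def using \<eta> by (intro tendstoD) auto
  then obtain X where X: "finite X" "\<And>Y. finite Y \<Longrightarrow> X \<subseteq> Y \<Longrightarrow> dist (\<Sum>s\<in>Y. \<bar>r s\<bar>) S < \<eta> / 2"
    unfolding eventually_finite_subsets_at_top by auto
  \<comment> \<open>Inserting zero keeps the maximum defined for empty \<open>X\<close> and makes it
    nonnegative, so \<open>nat\<close> does not change it.\<close>
  define m0 where "m0 = nat (Max (insert 0 (abs ` X)))"
  have Xm: "X \<subseteq> {-int m..int m}" if "m \<ge> m0" for m
  proof
    fix s assume "s \<in> X"
    hence "\<bar>s\<bar> \<le> Max (insert 0 (abs ` X))" using X(1) by (intro Max_ge) auto
    thus "s \<in> {-int m..int m}" using that unfolding m0_def by auto
  qed
  show ?thesis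
  proof (rule that)
    fix m F assume m: "m \<ge> m0" and F: "finite F" "F \<inter> {-int m..int m} = {}"
    \<comment> \<open>Both the interval and its union with \<open>F\<close> contain
      \<open>X\<close>, so their sums lie within \<open>\<eta> / 2\<close> of \<open>S\<close>; the
      difference is the sum over \<open>F\<close>.\<close>
    have "(\<Sum>s\<in>{-int m..int m} \<union> F. \<bar>r s\<bar>) = (\<Sum>s\<in>{-int m..int m}. \<bar>r s\<bar>) + (\<Sum>s\<in>F. \<bar>r s\<bar>)"
      using F by (intro sum.union_disjoint) auto
    moreover have "dist (\<Sum>s\<in>{-int m..int m} \<union> F. \<bar>r s\<bar>) S < \<eta> / 2"
      using F Xm[OF m] by (intro X(2)) auto
    moreover have "dist (\<Sum>s\<in>{-int m..int m}. \<bar>r s\<bar>) S < \<eta> / 2"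
      using Xm[OF m] by (intro X(2)) auto
    ultimately show "(\<Sum>s\<in>F. \<bar>r s\<bar>) \<le> \<eta>" unfolding dist_real_def by linarith
  qed
qed

text \<open>The exponentials have modulus one, so the tail of the Fourier series is dominated by the
  tail of the absolute autocovariances, uniformly in \<open>\<theta>\<close>.\<close>

lemma spectral_density_trig_bound:
  assumes sm: "(\<lambda>s. \<bar>autocov M Z s\<bar>) summable_on UNIV"
    and tail: "\<And>F. finite F \<Longrightarrow> F \<inter> {-int m..int m} = {} \<Longrightarrow> (\<Sum>s\<in>F. \<bar>autocov M Z s\<bar>) \<le> \<eta>"
  shows "\<bar>Re (spectral_density M Z \<theta>) - trig m (autocov M Z) \<theta>\<bar> \<le> \<eta>"
proof -
  define g where "g j = exp (2 * pi * \<i> * of_int j * of_real \<theta>) * complex_of_real (autocov M Z j)" for j :: int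
  have ng: "norm (g j) = \<bar>autocov M Z j\<bar>" for j
    by (simp add: g_def norm_mult norm_exp_eq_Re)
  have "g summable_on UNIV"
    by (rule abs_summable_summable) (simp add: ng sm)
  hence lim: "(sum g \<longlongrightarrow> spectral_density M Z \<theta>) (finite_subsets_at_top UNIV)"
    using has_sum_infsum unfolding has_sum_def spectral_density_def g_def by blast
  have "norm (spectral_density M Z \<theta> - sum g {-int m..int m}) \<le> \<eta>"
  proof (rule tendsto_upperbound)
    show "((\<lambda>X. norm (sum g X - sum g {-int m..int m})) \<longlongrightarrow> norm (spectral_density M Z \<theta> - sum g {-int m..int m})) (finite_subsets_at_top UNIV)"
      by (intro tendsto_intros lim)
    show "\<forall>\<^sub>F X in finite_subsets_at_top UNIV. norm (sum g X - sum g {-int m..int m}) \<le> \<eta>"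
      unfolding eventually_finite_subsets_at_top
    proof (intro exI[of _ "{-int m..int m}"] conjI allI impI)
      fix X assume "finite X \<and> {-int m..int m} \<subseteq> X \<and> X \<subseteq> (UNIV :: int set)"
      hence X: "finite X" "{-int m..int m} \<subseteq> X" by auto
      have "sum g X - sum g {-int m..int m} = sum g (X - {-int m..int m})"
        using X by (simp add: sum_diff)
      also have "norm \<dots> \<le> (\<Sum>s\<in>X - {-int m..int m}. \<bar>autocov M Z s\<bar>)"
        using norm_sum[of g] by (simp add: ng)
      also have "\<dots> \<le> \<eta>" using X by (intro tail) auto
      finally show "norm (sum g X - sum g {-int m..int m}) \<le> \<eta>" .
    qed auto
  qed simp
  moreover have "Re (sum g {-int m..int m}) = trig m (autocov M Z) \<theta>"
    unfolding trig_def Re_sum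
  proof (rule sum.cong[OF refl])
    fix j
    have "exp (2 * pi * \<i> * of_int j * of_real \<theta>) = cis (2 * pi * of_int j * \<theta>)"
      by (simp add: cis_conv_exp mult_ac)
    thus "Re (g j) = autocov M Z j * cos (2 * pi * of_int j * \<theta>)" by (simp add: g_def)
  qed
  ultimately show ?thesis
    using abs_Re_le_cmod[of "spectral_density M Z \<theta> - sum g {-int m..int m}"] by simp
qed

text \<open>The truncated symbols converge pointwise, and dominated convergence applies since
  \<open>f\<close> is bounded. Measurability of the limiting density is inherited from the
  continuous truncations.\<close>

lemma integral_nu_Z_limit:
  fixes f :: "real \<Rightarrow> real"
  assumes sm: "(\<lambda>s. \<bar>autocov M Z s\<bar>) summable_on UNIV"
    and f: "continuous_on UNIV f" and B: "\<And>x. \<bar>f x\<bar> \<le> B"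
  shows "(\<lambda>m. integral {0..1} (\<lambda>\<theta>. f (trig m (autocov M Z) \<theta>))) \<longlonglongrightarrow> (\<integral>x. f x \<partial>nu_Z M Z)"
proof -
  let ?L = "lebesgue_on {0..1::real}" and ?t = "\<lambda>m. trig m (autocov M Z)"
  let ?F = "\<lambda>\<theta>. Re (spectral_density M Z \<theta>)"
  have conv: "(\<lambda>m. ?t m \<theta>) \<longlonglongrightarrow> ?F \<theta>" for \<theta>
  proof (rule LIMSEQ_I)
    fix e :: real assume e: "e > 0"
    obtain m0 where m0: "\<And>m F. m \<ge> m0 \<Longrightarrow> finite F \<Longrightarrow> F \<inter> {-int m..int m} = {} \<Longrightarrow> (\<Sum>s\<in>F. \<bar>autocov M Z s\<bar>) \<le> e / 2"
      using abs_summable_int_tail[OF sm, of "e / 2"] e by auto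
    show "\<exists>no. \<forall>m\<ge>no. norm (?t m \<theta> - ?F \<theta>) < e"
    proof (intro exI[of _ m0] allI impI)
      fix m assume m: "m0 \<le> m"
      have "\<bar>?F \<theta> - ?t m \<theta>\<bar> \<le> e / 2"
        by (rule spectral_density_trig_bound[OF sm]) (rule m0[OF m])
      thus "norm (?t m \<theta> - ?F \<theta>) < e" using e by (simp add: abs_minus_commute)
    qed
  qed
  have mt: "?t m \<in> borel_measurable ?L" for m
    by (rule continuous_imp_measurable_on_sets_lebesgue[OF continuous_on_trig]) auto
  have mF: "?F \<in> borel_measurable ?L"
    by (rule borel_measurable_LIMSEQ_real[OF conv mt])
  have mf: "f \<in> borel_measurable borel" by (rule borel_measurable_continuous_onI[OF f])
  have "(\<lambda>m. integral\<^sup>L ?L (\<lambda>\<theta>. f (?t m \<theta>))) \<longlonglongrightarrow> integral\<^sup>L ?L (\<lambda>\<theta>. f (?F \<theta>))"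
  proof (rule integral_dominated_convergence[where w = "\<lambda>_. B"])
    show "(\<lambda>\<theta>. f (?F \<theta>)) \<in> borel_measurable ?L" by (rule measurable_compose[OF mF mf])
    show "(\<lambda>\<theta>. f (?t m \<theta>)) \<in> borel_measurable ?L" for m by (rule measurable_compose[OF mt mf])
    show "integrable ?L (\<lambda>_. B)" using continuous_imp_integrable_real[of 0 1 "\<lambda>_. B"] by simp
    show "AE \<theta> in ?L. (\<lambda>m. f (?t m \<theta>)) \<longlonglongrightarrow> f (?F \<theta>)"
    proof (rule AE_I2)
      fix \<theta>
      have "isCont f (?F \<theta>)" using f by (simp add: continuous_on_eq_continuous_at)
      thus "(\<lambda>m. f (?t m \<theta>)) \<longlonglongrightarrow> f (?F \<theta>)" by (rule isCont_tendsto_compose[OF _ conv])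
    qed
    show "AE \<theta> in ?L. norm (f (?t m \<theta>)) \<le> B" for m using B by simp
  qed
  moreover have "integral\<^sup>L ?L (\<lambda>\<theta>. f (?t m \<theta>)) = integral {0..1} (\<lambda>\<theta>. f (?t m \<theta>))" for m
  proof (rule lebesgue_integral_eq_integral)
    show "integrable ?L (\<lambda>\<theta>. f (?t m \<theta>))"
      by (intro continuous_imp_integrable_real continuous_on_compose2[OF f continuous_on_trig]) auto
  qed simp
  moreover have "(\<integral>x. f x \<partial>nu_Z M Z) = integral\<^sup>L ?L (\<lambda>\<theta>. f (?F \<theta>))"
    unfolding nu_Z_def by (rule integral_distr[OF mF mf])
  ultimately show ?thesis by simp
qed

section \<open>The banded matrix and its Toeplitz approximation\<close>

lemma banded_cov_carrier: "banded_cov Zc n b p \<omega> \<in> carrier_mat p p"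
  by (simp add: banded_cov_def)

lemma banded_cov_sym: "transpose_mat (banded_cov Zc n b p \<omega>) = banded_cov Zc n b p \<omega>"
  by (rule eq_matI) (auto simp: banded_cov_def abs_minus_commute mult.commute)

lemma banded_cov_entry:
  assumes "i < p" "j < p"
  shows "banded_cov Zc n b p \<omega> $$ (i, j) = (if \<bar>real i - real j\<bar> \<le> b
     then (\<Sum>k\<in>{1..n}. Zc k (int (i + 1)) \<omega> * Zc k (int (j + 1)) \<omega>) / n else 0)"
  using assms by (simp add: banded_cov_def sum_divide_distrib)

lemma sum_translates_le:
  fixes g :: "int \<Rightarrow> real"
  assumes "\<And>F. finite F \<Longrightarrow> (\<Sum>s\<in>F. g s) \<le> c"
  shows "(\<Sum>j<p. g (int j - int i)) \<le> c"
proof -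
  have "(\<Sum>j<p. g (int j - int i)) = (\<Sum>s\<in>(\<lambda>j. int j - int i) ` {..<p}. g s)"
    by (subst sum.reindex) (auto simp: inj_on_def)
  thus ?thesis using assms by simp
qed

context iid_stationary_copies
begin

text \<open>The bound for an entry depends only on its offset from the diagonal. Along a row, at
  most \<open>2 * b + 1\<close> offsets carry the variance bound, and the cut at \<open>m\<close>
  adds the squares of the removed covariances.\<close>

lemma banded_cov_deviation:
  fixes n :: nat and b :: real
  defines "R \<equiv> autocov M (Zc 0)"
  assumes n: "n > 0" and b: "b \<ge> 0" and m: "real m \<le> b"
    and tail: "\<And>F. finite F \<Longrightarrow> F \<inter> {-int m..int m} = {} \<Longrightarrow> (\<Sum>s\<in>F. \<bar>R s\<bar>) \<le> \<eta>"
  shows "expectation (\<lambda>\<omega>. \<Sum>i<p. \<Sum>j<p. (banded_cov Zc n b p \<omega> $$ (i, j) - toep m R i j)\<^sup>2)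
           \<le> real p * ((2 * b + 1) / n * fourth_moment + \<eta>\<^sup>2)"
    and "integrable M (\<lambda>\<omega>. \<Sum>i<p. \<Sum>j<p. (banded_cov Zc n b p \<omega> $$ (i, j) - toep m R i j)\<^sup>2)"
proof -
  \<comment> \<open>The first summand bounds the variance inside the band, the second is the squared
    bias beyond \<open>m\<close>. As \<open>b\<close> is real, integer offsets are compared with its
    floor.\<close>
  define g where "g s = of_bool (\<bar>s\<bar> \<le> \<lfloor>b\<rfloor>) * (fourth_moment / n) + of_bool (\<bar>s\<bar> > int m) * (R s)\<^sup>2" for s :: int
  have Rs: "R (- s) = R s" for s unfolding R_def by (rule autocov_minus)
  have entry: "expectation (\<lambda>\<omega>. (banded_cov Zc n b p \<omega> $$ (i, j) - toep m R i j)\<^sup>2) \<le> g (int j - int i)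
     \<and> integrable M (\<lambda>\<omega>. (banded_cov Zc n b p \<omega> $$ (i, j) - toep m R i j)\<^sup>2)"
    if ij: "i < p" "j < p" for i j
  proof (cases "\<bar>real i - real j\<bar> \<le> b")
    case True
    have le: "\<bar>int j - int i\<bar> \<le> \<lfloor>b\<rfloor>" using True by (simp add: le_floor_iff abs_minus_commute)
    have t: "R (int (j + 1) - int (i + 1)) = R (int i - int j)"
      using Rs[of "int i - int j"] by simp
    have *: "expectation (\<lambda>\<omega>. (banded_cov Zc n b p \<omega> $$ (i, j) - toep m R i j)\<^sup>2)
        \<le> fourth_moment / n + (R (int (j + 1) - int (i + 1)) - toep m R i j)\<^sup>2"
      "integrable M (\<lambda>\<omega>. (banded_cov Zc n b p \<omega> $$ (i, j) - toep m R i j)\<^sup>2)"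
      using sample_cov_deviation[OF n, of "int (i + 1)" "int (j + 1)" "toep m R i j"] True
      unfolding banded_cov_entry[OF ij] R_def by auto
    have "(R (int (j + 1) - int (i + 1)) - toep m R i j)\<^sup>2 = of_bool (\<bar>int j - int i\<bar> > int m) * (R (int j - int i))\<^sup>2"
      unfolding t using Rs[of "int i - int j"] by (auto simp: toep_def)
    thus ?thesis using * le by (simp add: g_def)
  next
    case False
    \<comment> \<open>Since \<open>m \<le> b\<close>, the Toeplitz band lies inside the band of the
      sample matrix, and outside the latter both entries vanish.\<close>
    have "\<not> \<bar>int i - int j\<bar> \<le> int m"
    proof
      assume "\<bar>int i - int j\<bar> \<le> int m"
      hence "real_of_int \<bar>int i - int j\<bar> \<le> real m" by linarith
      thus False using False m by simp
    qed
    hence "banded_cov Zc n b p \<omega> $$ (i, j) - toep m R i j = 0" for \<omega>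
      using False by (simp add: banded_cov_entry[OF ij] toep_def)
    moreover have "g s \<ge> 0" for s using fourth_moment_nonneg by (simp add: g_def)
    ultimately show ?thesis by simp
  qed
  have gsum: "(\<Sum>s\<in>F. g s) \<le> (2 * b + 1) / n * fourth_moment + \<eta>\<^sup>2" if F: "finite F" for F
  proof -
    have "(\<Sum>s\<in>F. of_bool (\<bar>s\<bar> \<le> \<lfloor>b\<rfloor>) * (fourth_moment / n)) \<le> (2 * b + 1) / n * fourth_moment"
    proof -
      have "(\<Sum>s\<in>F. of_bool (\<bar>s\<bar> \<le> \<lfloor>b\<rfloor>) * (fourth_moment / n)) = (\<Sum>s\<in>F \<inter> {-\<lfloor>b\<rfloor>..\<lfloor>b\<rfloor>}. fourth_moment / n)"
        by (rule sum.mono_neutral_cong_right) (use F in \<open>auto simp: abs_le_iff\<close>)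
      also have "\<dots> = real (card (F \<inter> {-\<lfloor>b\<rfloor>..\<lfloor>b\<rfloor>})) * (fourth_moment / n)" by simp
      also have "\<dots> \<le> (2 * b + 1) * (fourth_moment / n)"
      proof (rule mult_right_mono)
        have "card (F \<inter> {-\<lfloor>b\<rfloor>..\<lfloor>b\<rfloor>}) \<le> card {-\<lfloor>b\<rfloor>..\<lfloor>b\<rfloor>}" by (intro card_mono) auto
        also have "\<dots> = nat (2 * \<lfloor>b\<rfloor> + 1)" by simp
        finally have "real (card (F \<inter> {-\<lfloor>b\<rfloor>..\<lfloor>b\<rfloor>})) \<le> real (nat (2 * \<lfloor>b\<rfloor> + 1))" by linarith
        also have "\<dots> = 2 * of_int \<lfloor>b\<rfloor> + 1" using b by simp
        also have "\<dots> \<le> 2 * b + 1" by simp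
        finally show "real (card (F \<inter> {-\<lfloor>b\<rfloor>..\<lfloor>b\<rfloor>})) \<le> 2 * b + 1" .
        show "0 \<le> fourth_moment / n" using fourth_moment_nonneg by simp
      qed
      finally show ?thesis by simp
    qed
    moreover have "(\<Sum>s\<in>F. of_bool (\<bar>s\<bar> > int m) * (R s)\<^sup>2) \<le> \<eta>\<^sup>2"
    proof -
      let ?F = "F - {-int m..int m}"
      have "(\<Sum>s\<in>F. of_bool (\<bar>s\<bar> > int m) * (R s)\<^sup>2) = (\<Sum>s\<in>?F. \<bar>R s\<bar> * \<bar>R s\<bar>)"
        by (rule sum.mono_neutral_cong_right) (use F in \<open>auto simp: power2_eq_square\<close>)
      \<comment> \<open>Each term is at most the whole tail sum, so the sum of squares is at most
        the square of the sum.\<close>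
      also have "\<dots> \<le> (\<Sum>s\<in>?F. \<bar>R s\<bar> * (\<Sum>s\<in>?F. \<bar>R s\<bar>))"
        by (intro sum_mono mult_left_mono member_le_sum) (use F in auto)
      also have "\<dots> = (\<Sum>s\<in>?F. \<bar>R s\<bar>)\<^sup>2" by (simp add: sum_distrib_right power2_eq_square)
      also have "\<dots> \<le> \<eta>\<^sup>2" by (intro power_mono tail sum_nonneg) (use F in auto)
      finally show ?thesis .
    qed
    ultimately show ?thesis by (simp add: g_def sum.distrib)
  qed
  show "integrable M (\<lambda>\<omega>. \<Sum>i<p. \<Sum>j<p. (banded_cov Zc n b p \<omega> $$ (i, j) - toep m R i j)\<^sup>2)"
    by (intro Bochner_Integration.integrable_sum) (use entry in auto)
  have "expectation (\<lambda>\<omega>. \<Sum>i<p. \<Sum>j<p. (banded_cov Zc n b p \<omega> $$ (i, j) - toep m R i j)\<^sup>2)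
     = (\<Sum>i<p. \<Sum>j<p. expectation (\<lambda>\<omega>. (banded_cov Zc n b p \<omega> $$ (i, j) - toep m R i j)\<^sup>2))"
  proof (subst Bochner_Integration.integral_sum)
    show "integrable M (\<lambda>\<omega>. \<Sum>j<p. (banded_cov Zc n b p \<omega> $$ (i, j) - toep m R i j)\<^sup>2)" if "i \<in> {..<p}" for i
      by (intro Bochner_Integration.integrable_sum) (use entry that in auto)
    show "(\<Sum>i<p. expectation (\<lambda>\<omega>. \<Sum>j<p. (banded_cov Zc n b p \<omega> $$ (i, j) - toep m R i j)\<^sup>2))
      = (\<Sum>i<p. \<Sum>j<p. expectation (\<lambda>\<omega>. (banded_cov Zc n b p \<omega> $$ (i, j) - toep m R i j)\<^sup>2))"
      by (rule sum.cong[OF refl], rule Bochner_Integration.integral_sum) (use entry in auto)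
  qed
  also have "\<dots> \<le> (\<Sum>i<p. \<Sum>j<p. g (int j - int i))"
    by (intro sum_mono) (use entry in auto)
  also have "\<dots> \<le> (\<Sum>i<p. (2 * b + 1) / n * fourth_moment + \<eta>\<^sup>2)"
    by (intro sum_mono sum_translates_le gsum)
  finally show "expectation (\<lambda>\<omega>. \<Sum>i<p. \<Sum>j<p. (banded_cov Zc n b p \<omega> $$ (i, j) - toep m R i j)\<^sup>2)
           \<le> real p * ((2 * b + 1) / n * fourth_moment + \<eta>\<^sup>2)" by simp
qed

lemma measurable_integral_empirical:
  fixes f :: "real \<Rightarrow> real"
  assumes f: "continuous_on UNIV f"
  shows "(\<lambda>\<omega>. \<integral>x. f x \<partial>(empirical_eigen_measure (banded_cov Zc n b p \<omega>))) \<in> borel_measurable M"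
proof (cases "p = 0")
  case True
  \<comment> \<open>Without indices the matrix is the same for every \<open>\<omega>\<close>, so the
    integral is constant, whatever its value.\<close>
  have "banded_cov Zc n b p \<omega> = 0\<^sub>m 0 0" for \<omega> by (rule eq_matI) (auto simp: banded_cov_def True)
  thus ?thesis by simp
next
  case False
  have "\<forall>\<omega>. \<exists>d u. spectral_decomp p (\<lambda>i j. banded_cov Zc n b p \<omega> $$ (i, j)) d u \<and>
      proots (char_poly (banded_cov Zc n b p \<omega>)) = mset (map d [0..<p])"
    by (intro allI spectral_decomp_ex banded_cov_carrier banded_cov_sym)
  then obtain d u where du: "\<And>\<omega>. spectral_decomp p (\<lambda>i j. banded_cov Zc n b p \<omega> $$ (i, j)) (d \<omega>) (u \<omega>)"
      "\<And>\<omega>. proots (char_poly (banded_cov Zc n b p \<omega>)) = mset (map (d \<omega>) [0..<p])" by metis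
  have "(\<lambda>\<omega>. \<Sum>i<p. f (d \<omega> i)) \<in> borel_measurable M"
  proof (rule borel_measurable_sum_eigenvalues[OF _ du(1) f])
    fix i j assume ij: "i < p" "j < p"
    show "(\<lambda>\<omega>. banded_cov Zc n b p \<omega> $$ (i, j)) \<in> borel_measurable M"
      unfolding banded_cov_entry[OF ij]
      by (cases "\<bar>real i - real j\<bar> \<le> b")
        (auto intro!: borel_measurable_divide borel_measurable_sum borel_measurable_times meas)
  qed
  hence "(\<lambda>\<omega>. (\<Sum>i<p. f (d \<omega> i)) / real p) \<in> borel_measurable M" by simp
  thus ?thesis using False by (simp add: integral_empirical_eigen_measure[OF _ du(2)])
qed

text \<open>The order of choices matters: \<open>\<epsilon>\<close> fixes \<open>C\<close>, then
  \<open>\<epsilon>\<close>, \<open>\<zeta>\<close> and \<open>C\<close> fix the cut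
  \<open>m\<close>, and only then does \<open>p\<close> grow. Of four errors of size
  \<open>\<epsilon> / 4\<close> three are deterministic; the fourth, from the Frobenius distance, is
  controlled outside an event of small probability by Markov's inequality.\<close>

lemma empirical_weak_conv:
  fixes b :: "nat \<Rightarrow> real" and n :: "nat \<Rightarrow> nat"
  assumes A_pos: "\<And>p. p > 0 \<Longrightarrow> b p > 0 \<and> n p > 0"
    and A_b: "filterlim b at_top sequentially"
    and A_n: "filterlim n at_top sequentially"
    and A_bn: "(\<lambda>p. b p / real (n p)) \<longlonglongrightarrow> 0"
    and sm: "(\<lambda>s. \<bar>autocov M (Zc 0) s\<bar>) summable_on UNIV"
  shows "weak_conv_in_prob M (\<lambda>p \<omega>. empirical_eigen_measure (banded_cov Zc (n p) (b p) p \<omega>)) (nu_Z M (Zc 0))"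
  unfolding weak_conv_in_prob_def
proof (intro allI impI conjI measurable_integral_empirical)
  fix f :: "real \<Rightarrow> real" assume f': "continuous_on UNIV f \<and> bounded (range f)"
  thus f: "continuous_on UNIV f" by simp
  obtain B where B: "\<And>x. \<bar>f x\<bar> \<le> B" using f' unfolding bounded_iff by auto
  fix \<epsilon> :: real assume \<epsilon>: "\<epsilon> > 0"
  define R where "R = autocov M (Zc 0)"
  define I where "I = (\<integral>x. f x \<partial>nu_Z M (Zc 0))"
  \<comment> \<open>Bounds the spectra of the Toeplitz truncations for all \<open>m\<close> and
    \<open>p\<close>, so that \<open>C\<close> can be fixed before \<open>m\<close>.\<close>
  define K where "K = (\<Sum>\<^sub>\<infinity>s. \<bar>R s\<bar>)"
  define L where "L p \<omega> = (\<integral>x. f x \<partial>(empirical_eigen_measure (banded_cov Zc (n p) (b p) p \<omega>)))" for p \<omega>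
  have Rs: "R (- s) = R s" for s unfolding R_def by (rule autocov_minus)
  have K: "(\<Sum>s\<in>F. \<bar>R s\<bar>) \<le> K" if "finite F" for F
    unfolding K_def using sm that by (intro finite_sum_le_infsum) (auto simp: R_def)
  obtain C where C: "C > 0" "\<And>x y. \<bar>y\<bar> \<le> K \<Longrightarrow> \<bar>f x - f y\<bar> \<le> \<epsilon> / 4 + C * (x - y)\<^sup>2"
    using bounded_continuous_quadratic_bound[OF f B, of "\<epsilon> / 4" K] \<epsilon> by auto
  show "(\<lambda>p. prob {\<omega> \<in> space M. \<bar>L p \<omega> - I\<bar> > \<epsilon>}) \<longlonglongrightarrow> 0"
  proof (rule LIMSEQ_I)
    fix \<zeta> :: real assume \<zeta>: "\<zeta> > 0"
    \<comment> \<open>Makes the truncation part of the Markov bound,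
      \<open>\<eta>\<^sup>2 * (4 * C / \<epsilon>)\<close>, equal to
      \<open>\<zeta> / 4\<close>.\<close>
    define \<eta> where "\<eta> = sqrt (\<zeta> * \<epsilon> / (16 * C))"
    have \<eta>: "\<eta> > 0" "\<eta>\<^sup>2 = \<zeta> * \<epsilon> / (16 * C)" using \<zeta> \<epsilon> C by (auto simp: \<eta>_def)
    obtain m1 where m1: "\<And>m F. m \<ge> m1 \<Longrightarrow> finite F \<Longrightarrow> F \<inter> {-int m..int m} = {} \<Longrightarrow> (\<Sum>s\<in>F. \<bar>R s\<bar>) \<le> \<eta>"
      using abs_summable_int_tail[OF sm \<eta>(1)] unfolding R_def by blast
    have "(\<lambda>m. integral {0..1} (\<lambda>\<theta>. f (trig m R \<theta>))) \<longlonglongrightarrow> I"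
      unfolding I_def R_def by (rule integral_nu_Z_limit[OF sm f B])
    from LIMSEQ_D[OF this, of "\<epsilon> / 4"] \<epsilon>
    obtain m2 where m2: "\<And>m. m \<ge> m2 \<Longrightarrow> \<bar>integral {0..1} (\<lambda>\<theta>. f (trig m R \<theta>)) - I\<bar> < \<epsilon> / 4"
      by auto
    define m where "m = max m1 m2"
    define Im where "Im = integral {0..1} (\<lambda>\<theta>. f (trig m R \<theta>))"
    have Im: "\<bar>Im - I\<bar> < \<epsilon> / 4" unfolding Im_def by (rule m2) (simp add: m_def)
    have tail: "(\<Sum>s\<in>F. \<bar>R s\<bar>) \<le> \<eta>" if "finite F" "F \<inter> {-int m..int m} = {}" for F
      by (rule m1[OF _ that]) (simp add: m_def)
    have "\<forall>p. \<exists>e v. spectral_decomp p (toep m R) e v"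
    proof
      fix p
      let ?A = "mat p p (\<lambda>(i, j). toep m R i j)"
      have "transpose_mat ?A = ?A" by (rule eq_matI) (auto simp: toep_sym[of R, OF Rs])
      then obtain e v where "spectral_decomp p (\<lambda>i j. ?A $$ (i, j)) e v"
        using spectral_decomp_ex[of ?A p] by auto
      thus "\<exists>e v. spectral_decomp p (toep m R) e v" unfolding spectral_decomp_def by (intro exI[of _ e] exI[of _ v]) auto
    qed
    then obtain e v where T: "\<And>p. spectral_decomp p (toep m R) (e p) (v p)" by metis
    have eK: "\<bar>e p i\<bar> \<le> K" if "i < p" for p i
    proof (rule spectral_decomp_eigenvalue_bound[OF T _ that])
      fix b
      have "(\<Sum>a<p. \<bar>toep m R a b\<bar>) = (\<Sum>a<p. \<bar>toep m R b a\<bar>)" by (simp add: toep_sym[of R m _ b, OF Rs])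
      also have "\<dots> \<le> K" by (intro order_trans[OF toep_abs_row_sum] K) auto
      finally show "(\<Sum>a<p. \<bar>toep m R a b\<bar>) \<le> K" .
    qed
    have "(\<lambda>p. (\<Sum>i<p. f (e p i)) / real p) \<longlonglongrightarrow> Im"
      unfolding Im_def by (rule toep_eigenvalues_tendsto[OF Rs f T])
    hence ev1: "\<forall>\<^sub>F p in sequentially. \<bar>(\<Sum>i<p. f (e p i)) / real p - Im\<bar> < \<epsilon> / 4"
      using tendstoD[of _ Im sequentially "\<epsilon> / 4"] \<epsilon> by (simp add: dist_real_def)
    \<comment> \<open>The variance part of the Markov bound, in the form in which it appears
      below.\<close>
    have "(\<lambda>p. (2 * (b p / real (n p)) + 1 / real (n p)) * fourth_moment * (4 * C / \<epsilon>)) \<longlonglongrightarrow> (2 * 0 + 0) * fourth_moment * (4 * C / \<epsilon>)"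
      by (intro tendsto_intros A_bn tendsto_divide_0[OF tendsto_const]
          filterlim_compose[OF filterlim_at_top_imp_at_infinity filterlim_compose[OF filterlim_real_sequentially A_n]]
          filterlim_at_top_imp_at_infinity filterlim_compose[OF filterlim_real_sequentially A_n])
    hence ev2: "\<forall>\<^sub>F p in sequentially. (2 * (b p / real (n p)) + 1 / real (n p)) * fourth_moment * (4 * C / \<epsilon>) < \<zeta> / 2"
      using \<zeta> by (intro order_tendstoD(2)[of _ 0]) auto
    have ev3: "\<forall>\<^sub>F p in sequentially. real m \<le> b p"
      using A_b unfolding filterlim_at_top by blast
    have "\<forall>\<^sub>F p in sequentially. norm (prob {\<omega> \<in> space M. \<bar>L p \<omega> - I\<bar> > \<epsilon>} - 0) < \<zeta>"
      using ev1 ev2 ev3 eventually_gt_at_top[of 0]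
    proof eventually_elim
      case (elim p)
      have np: "n p > 0" "b p \<ge> 0" using A_pos[OF elim(4)] by auto
      define D where "D \<omega> = (\<Sum>i<p. \<Sum>j<p. (banded_cov Zc (n p) (b p) p \<omega> $$ (i, j) - toep m R i j)\<^sup>2)" for \<omega>
      have D: "expectation D \<le> real p * ((2 * b p + 1) / n p * fourth_moment + \<eta>\<^sup>2)" "integrable M D"
        unfolding D_def[abs_def] R_def
        by (rule banded_cov_deviation[OF np elim(3) tail[unfolded R_def]]; assumption)+
      \<comment> \<open>The value of \<open>D \<omega>\<close> at which
        \<open>C * D \<omega> / p\<close> reaches \<open>\<epsilon> / 4\<close>.\<close>
      define c where "c = real p * \<epsilon> / (4 * C)"
      have c: "c > 0" using elim(4) \<epsilon> C by (simp add: c_def)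
      have close: "\<bar>L p \<omega> - (\<Sum>i<p. f (e p i)) / real p\<bar> \<le> \<epsilon> / 4 + C * D \<omega> / p" for \<omega>
      proof -
        obtain d u where du: "spectral_decomp p (\<lambda>i j. banded_cov Zc (n p) (b p) p \<omega> $$ (i, j)) d u"
          "proots (char_poly (banded_cov Zc (n p) (b p) p \<omega>)) = mset (map d [0..<p])"
          using spectral_decomp_ex[OF banded_cov_carrier[of Zc "n p" "b p" p \<omega>] banded_cov_sym] by blast
        have "\<bar>(\<Sum>i<p. f (d i)) - (\<Sum>j<p. f (e p j))\<bar> \<le> \<epsilon> / 4 * p + C * D \<omega>"
          unfolding D_def by (rule spectral_comparison[OF du(1) T]) (intro C eK)
        hence "\<bar>(\<Sum>i<p. f (d i)) - (\<Sum>j<p. f (e p j))\<bar> / p \<le> (\<epsilon> / 4 * p + C * D \<omega>) / p"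
          by (rule divide_right_mono) simp
        moreover have "L p \<omega> = (\<Sum>i<p. f (d i)) / p"
          unfolding L_def by (rule integral_empirical_eigen_measure[OF elim(4) du(2)])
        ultimately show ?thesis using elim(4)
          by (simp add: add_divide_distrib flip: diff_divide_distrib)
      qed
      have sub: "{\<omega> \<in> space M. \<bar>L p \<omega> - I\<bar> > \<epsilon>} \<subseteq> {\<omega> \<in> space M. D \<omega> \<ge> c}"
      proof (safe, rule ccontr)
        fix \<omega> assume 1: "\<bar>L p \<omega> - I\<bar> > \<epsilon>" and "\<not> c \<le> D \<omega>"
        hence "C * D \<omega> / p \<le> \<epsilon> / 4" using elim(4) C by (simp add: c_def field_simps)
        thus False using 1 close[of \<omega>] elim(1) Im by linarith
      qed
      have "prob {\<omega> \<in> space M. \<bar>L p \<omega> - I\<bar> > \<epsilon>} \<le> prob {\<omega> \<in> space M. D \<omega> \<ge> c}"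
        by (intro finite_measure_mono sub) (use D(2) in measurable)
      also have "\<dots> \<le> expectation D / c"
        by (rule integral_Markov_inequality_measure[OF D(2) sets.empty_sets _ c]) (simp add: D_def sum_nonneg)
      also have "\<dots> \<le> real p * ((2 * b p + 1) / n p * fourth_moment + \<eta>\<^sup>2) / c"
        using D(1) c by (intro divide_right_mono) auto
      also have "\<dots> = (2 * (b p / real (n p)) + 1 / real (n p)) * fourth_moment * (4 * C / \<epsilon>) + \<eta>\<^sup>2 * (4 * C / \<epsilon>)"
        using elim(4) \<epsilon> C np by (simp add: c_def field_simps)
      also have "\<eta>\<^sup>2 * (4 * C / \<epsilon>) = \<zeta> / 4" using \<epsilon> C by (simp add: \<eta>(2))
      also have "(2 * (b p / real (n p)) + 1 / real (n p)) * fourth_moment * (4 * C / \<epsilon>) + \<zeta> / 4 < \<zeta>"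
        using elim(2) \<zeta> by linarith
      finally show ?case by simp
    qed
    thus "\<exists>no. \<forall>p\<ge>no. norm (prob {\<omega> \<in> space M. \<bar>L p \<omega> - I\<bar> > \<epsilon>} - 0) < \<zeta>"
      unfolding eventually_sequentially .
  qed
qed

end

theorem theorem2p3:
  fixes M :: "'a measure"
    and Zc :: "nat \<Rightarrow> int \<Rightarrow> 'a \<Rightarrow> real"
    and b :: "nat \<Rightarrow> real"
    and n :: "nat \<Rightarrow> nat"
  assumes prob: "prob_space M"
    (* Assumption A *)
    and A_pos: "\<And>p. p > 0 \<Longrightarrow> b p > 0 \<and> n p > 0 \<and> b p \<le> real p"
    and A_b: "filterlim b at_top sequentially"
    and A_n: "filterlim n at_top sequentially"
    and A_bn: "(\<lambda>p. b p / real (n p)) \<longlonglongrightarrow> 0"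
    (* the Zc i are i.i.d. copies of a real stationary sequence *)
    and meas: "\<And>i j. Zc i j \<in> borel_measurable M"
    and indep: "prob_space.indep_vars M (\<lambda>_. PiM (UNIV :: int set) (\<lambda>_. borel))
                  (\<lambda>i \<omega>. \<lambda>j. Zc i j \<omega>) UNIV"
    and ident: "\<And>i. distr M (PiM (UNIV :: int set) (\<lambda>_. borel)) (\<lambda>\<omega> j. Zc i j \<omega>)
                   = distr M (PiM (UNIV :: int set) (\<lambda>_. borel)) (\<lambda>\<omega> j. Zc 0 j \<omega>)"
    and stationary: "\<And>s. distr M (PiM (UNIV :: int set) (\<lambda>_. borel)) (\<lambda>\<omega> j. Zc 0 (j + s) \<omega>)
                   = distr M (PiM (UNIV :: int set) (\<lambda>_. borel)) (\<lambda>\<omega> j. Zc 0 j \<omega>)"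
    (* Assumption Z *)
    and Z_moments: "\<And>k::nat. integrable M (\<lambda>\<omega>. \<bar>Zc 0 0 \<omega>\<bar> ^ k)"
    and Z_mean: "(\<integral>\<omega>. Zc 0 0 \<omega> \<partial>M) = 0"
    and Z_cumulants: "\<And>r::nat. r \<ge> 1 \<Longrightarrow>
          (\<lambda>js. norm (cumulant M (map (\<lambda>j. Zc 0 j) (0 # js)))) summable_on {js :: int list. length js = r}"
  shows "weak_conv_in_prob M
           (\<lambda>p \<omega>. empirical_eigen_measure (banded_cov Zc (n p) (b p) p \<omega>))
           (nu_Z M (Zc 0))"
proof -
  interpret iid_stationary_copies M Zc
    using assms by (intro iid_stationary_copies.intro iid_stationary_copies_axioms.intro) auto
  \<comment> \<open>Lists of length one correspond to integers, which turns the case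
    \<open>r = 1\<close> of the cumulant condition into a series over offsets.\<close>
  have "bij_betw (\<lambda>j. [j]) UNIV {js :: int list. length js = 1}"
    by (rule bij_betwI[where g = hd]) (auto simp: length_Suc_conv)
  hence "(\<lambda>j. norm (cumulant M (map (\<lambda>j. Zc 0 j) (0 # [j])))) summable_on UNIV"
    using Z_cumulants[of 1] summable_on_reindex_bij_betw by fastforce
  hence "(\<lambda>j. \<bar>autocov M (Zc 0) j\<bar>) summable_on UNIV" by (simp add: cumulant_eq_autocov)
  thus ?thesis using A_pos A_b A_n A_bn by (intro empirical_weak_conv) auto
qed

end
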